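(* There exist a constant $c>0$ and a set $\mathcal{S}$ of primes $p\ge 3$, of positive relative density within the primes, such that for every $p\in\mathcal{S}$, $$c\,(\log\log p)^{1/4}\le \Delta(p).$$
   Context: For a positive integer $N\ge 2$, $\Delta(N)$ denotes the smallest real number such that, for all complex numbers $a_n$ (indexed by $1\le n\le N-1$ with $(n,N)=1$), $$\left(\frac{1}{\phi(N)}\sum_{\chi \bmod N}\left|\max_{1\le \ell<N}\left|\sum_{\substack{1\le n\le \ell\\ (n,N)=1}}a_n\chi(n)\right|\right|^2\right)^{1/2}\le \Delta(N)\left(\sum_{\substack{1\le n\le N-1\\ (n,N)=1}}|a_n|^2\right)^{1/2},$$ where the outer sum on the left is over all Dirichlet characters $\chi$ modulo $N$ and $\phi$ is the Euler totient function. A set $\mathcal{S}$ of primes has positive relative density within the primes if $$\liminf_{X\to\infty}\frac{|\{p\in\mathcal{S}:p\le X\}|}{|\{p\le X:\ p\text{ prime}\}|}>0.$$ *)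

theory Defs
  imports "HOL-Analysis.Analysis" "HOL-Number_Theory.Number_Theory"
begin

definition dirichlet_character :: "nat \<Rightarrow> (int \<Rightarrow> complex) \<Rightarrow> bool" where
  "dirichlet_character N \<psi> \<longleftrightarrow>
     (\<forall>m n. \<psi> (m * n) = \<psi> m * \<psi> n) \<and>
     (\<forall>n. \<psi> (n + int N) = \<psi> n) \<and>
     (\<forall>n. \<psi> n \<noteq> 0 \<longleftrightarrow> coprime n (int N))"

lemma dirichlet_character_cong:
  assumes "dirichlet_character N \<psi>" "[m = n] (mod int N)"
  shows "\<psi> m = \<psi> n"
proof -
  have p: "\<psi> (x + int N) = \<psi> x" for x
    using assms(1) by (auto simp: dirichlet_character_def)
  have nat: "\<psi> (x + int k * int N) = \<psi> x" for x k
  proof (induction k)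
    case (Suc k)
    then show ?case using p[of "x + int k * int N"] by (simp add: algebra_simps)
  qed simp
  obtain k where k: "n = m + int N * k"
    using assms(2) by (metis cong_iff_lin mult.commute)
  show ?thesis
  proof (cases "k \<ge> 0")
    case True
    then show ?thesis using nat[of m "nat k"] k by (simp add: mult.commute)
  next
    case False
    then show ?thesis using nat[of n "nat (- k)"] k by (simp add: mult.commute)
  qed
qed

lemma dirichlet_character_root_of_unity:
  assumes "dirichlet_character N \<psi>" "N > 0" "coprime n (int N)"
  shows "\<psi> n ^ totient N = 1"
proof -
  have mult: "\<psi> (x * y) = \<psi> x * \<psi> y" for x y
    using assms(1) by (auto simp: dirichlet_character_def)
  have "\<psi> 1 \<noteq> 0" using assms(1) by (auto simp: dirichlet_character_def)
  then have one: "\<psi> 1 = 1" using mult[of 1 1] by simp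
  have pow: "\<psi> (x ^ k) = \<psi> x ^ k" for x k
    by (induction k) (auto simp: one mult)
  define r where "r = nat (n mod int N)"
  have r: "int r = n mod int N" using assms(2) by (simp add: r_def)
  have nr: "[int r = n] (mod int N)" by (simp add: r cong_def)
  have "coprime (int r) (int N)"
    using assms(3) nr cong_imp_coprime cong_sym by blast
  then have "[r ^ totient N = 1] (mod N)" by (intro euler_theorem) simp
  then have "[int r ^ totient N = 1] (mod int N)"
    by (metis cong_int_iff of_nat_1 of_nat_power)
  then have "\<psi> (int r) ^ totient N = 1"
    using dirichlet_character_cong[OF assms(1)] pow one by metis
  then show ?thesis using dirichlet_character_cong[OF assms(1) nr] by simp
qed

lemma norm_dirichlet_character_le:
  assumes "dirichlet_character N \<psi>" "N > 0"
  shows "norm (\<psi> n) \<le> 1"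
proof (cases "coprime n (int N)")
  case True
  then have "norm (\<psi> n) ^ totient N = 1"
    using dirichlet_character_root_of_unity[OF assms True] by (metis norm_one norm_power)
  then show ?thesis
    using assms(2) by (metis norm_ge_zero order_refl power_eq_1_iff totient_gt_0_iff real_norm_def abs_of_nonneg neq0_conv)
next
  case False
  then show ?thesis using assms(1) by (auto simp: dirichlet_character_def)
qed

lemma finite_dirichlet_characters:
  assumes "N > 0"
  shows "finite {\<psi>. dirichlet_character N \<psi>}"
proof -
  let ?Z = "insert 0 {z::complex. z ^ totient N = 1}"
  have "finite {z::complex. z ^ totient N = 1}"
    using assms by (intro finite_roots_unity) (simp add: Suc_le_eq)
  then have fin: "finite (PiE {0..<int N} (\<lambda>_. ?Z))" by (intro finite_PiE) auto
  let ?f = "\<lambda>\<psi>. restrict \<psi> {0..<int N}"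
  have "\<psi> n \<in> ?Z" if "dirichlet_character N \<psi>" for \<psi> n
    using dirichlet_character_root_of_unity[OF that assms, of n] that
    by (cases "coprime n (int N)") (auto simp: dirichlet_character_def)
  then have "?f ` {\<psi>. dirichlet_character N \<psi>} \<subseteq> PiE {0..<int N} (\<lambda>_. ?Z)"
    by (intro image_subsetI restrict_PiE_iff[THEN iffD2] ballI) simp
  moreover have "inj_on ?f {\<psi>. dirichlet_character N \<psi>}"
  proof (intro inj_onI ext)
    fix \<psi> \<xi> :: "int \<Rightarrow> complex" and n :: int
    assume a: "\<psi> \<in> {\<psi>. dirichlet_character N \<psi>}" "\<xi> \<in> {\<psi>. dirichlet_character N \<psi>}" "?f \<psi> = ?f \<xi>"
    have "n mod int N \<in> {0..<int N}" using assms by simp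
    then have "\<psi> (n mod int N) = \<xi> (n mod int N)" using a(3) by (metis restrict_apply')
    moreover have "[n mod int N = n] (mod int N)" by simp
    ultimately show "\<psi> n = \<xi> n" using a(1,2) dirichlet_character_cong by (metis mem_Collect_eq)
  qed
  ultimately show ?thesis using fin by (meson inj_on_finite)
qed

definition max_char_sum :: "nat \<Rightarrow> (nat \<Rightarrow> complex) \<Rightarrow> (int \<Rightarrow> complex) \<Rightarrow> real" where
  "max_char_sum N a \<psi> =
     Max ((\<lambda>l. norm (\<Sum>n | n \<in> {1..l} \<and> coprime n N. a n * \<psi> (int n))) ` {1..<N})"

definition maximal_sieve_bound :: "nat \<Rightarrow> real \<Rightarrow> bool" where
  "maximal_sieve_bound N D \<longleftrightarrow>
     (\<forall>a :: nat \<Rightarrow> complex.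
        sqrt (1 / real (totient N) *
              (\<Sum>\<psi> | dirichlet_character N \<psi>. \<bar>max_char_sum N a \<psi>\<bar>\<^sup>2))
        \<le> D * sqrt (\<Sum>n | n \<in> {1..N-1} \<and> coprime n N. (norm (a n))\<^sup>2))"

(* LEAST is meaningful for N >= 2 only: see Delta_properties below. *)
definition Delta :: "nat \<Rightarrow> real" where
  "Delta N = (LEAST D. maximal_sieve_bound N D)"

lemma maximal_sieve_bound_exists:
  assumes "N \<ge> 2"
  shows "\<exists>D. maximal_sieve_bound N D"
proof -
  let ?X = "{\<psi>. dirichlet_character N \<psi>}"
  define C where "C = sqrt (1 / real (totient N) * (\<Sum>\<psi>\<in>?X. (real N)\<^sup>2))"
  have "sqrt (1 / real (totient N) * (\<Sum>\<psi>\<in>?X. \<bar>max_char_sum N a \<psi>\<bar>\<^sup>2))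
        \<le> C * sqrt (\<Sum>n | n \<in> {1..N-1} \<and> coprime n N. (norm (a n))\<^sup>2)" for a
  proof -
    define R where "R = sqrt (\<Sum>n | n \<in> {1..N-1} \<and> coprime n N. (norm (a n))\<^sup>2)"
    have R0: "R \<ge> 0" by (simp add: R_def sum_nonneg)
    have an: "norm (a n) \<le> R" if "n \<in> {1..N-1}" "coprime n N" for n
    proof -
      have "(norm (a n))\<^sup>2 \<le> (\<Sum>n | n \<in> {1..N-1} \<and> coprime n N. (norm (a n))\<^sup>2)"
        using that by (intro member_le_sum) auto
      then show ?thesis unfolding R_def by (rule real_le_rsqrt)
    qed
    have "\<bar>max_char_sum N a \<psi>\<bar>\<^sup>2 \<le> (real N)\<^sup>2 * R\<^sup>2" if \<psi>: "\<psi> \<in> ?X" for \<psi>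
    proof -
      have le: "norm (\<Sum>n | n \<in> {1..l} \<and> coprime n N. a n * \<psi> (int n)) \<le> real N * R"
        if l: "l \<in> {1..<N}" for l
      proof -
        have "norm (\<Sum>n | n \<in> {1..l} \<and> coprime n N. a n * \<psi> (int n))
              \<le> of_nat (card {n. n \<in> {1..l} \<and> coprime n N}) * R"
        proof (rule sum_norm_bound)
          fix n assume n: "n \<in> {n. n \<in> {1..l} \<and> coprime n N}"
          have "norm (a n) * norm (\<psi> (int n)) \<le> R * 1"
            using n l R0 \<psi> assms
            by (intro mult_mono an norm_dirichlet_character_le[of N]) auto
          then show "norm (a n * \<psi> (int n)) \<le> R" by (simp add: norm_mult)
        qed
        moreover have "card {n. n \<in> {1..l} \<and> coprime n N} \<le> card {1..l}"
          by (intro card_mono) auto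
        ultimately show ?thesis
          using l R0 by (smt (verit) mult_right_mono of_nat_le_iff card_atLeastAtMost
              atLeastLessThan_iff diff_Suc_1 less_imp_le_nat of_nat_mono)
      qed
      have ne: "{1..<N} \<noteq> {}" using assms by auto
      have "max_char_sum N a \<psi> \<le> real N * R"
        unfolding max_char_sum_def using ne le by (subst Max_le_iff) auto
      moreover have "max_char_sum N a \<psi> \<ge> 0"
        unfolding max_char_sum_def using ne by (subst Max_ge_iff) auto
      ultimately show ?thesis by (simp add: power_mono flip: power_mult_distrib)
    qed
    then have "(\<Sum>\<psi>\<in>?X. \<bar>max_char_sum N a \<psi>\<bar>\<^sup>2) \<le> (\<Sum>\<psi>\<in>?X. (real N)\<^sup>2 * R\<^sup>2)"
      by (intro sum_mono)
    also have "\<dots> = (\<Sum>\<psi>\<in>?X. (real N)\<^sup>2) * R\<^sup>2" by (simp add: sum_distrib_right)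
    finally have "sqrt (1 / real (totient N) * (\<Sum>\<psi>\<in>?X. \<bar>max_char_sum N a \<psi>\<bar>\<^sup>2))
        \<le> sqrt ((1 / real (totient N) * (\<Sum>\<psi>\<in>?X. (real N)\<^sup>2)) * R\<^sup>2)"
      by (simp add: divide_right_mono)
    also have "\<dots> = C * R" using R0 by (simp only: C_def real_sqrt_mult real_sqrt_abs abs_of_nonneg)
    finally show ?thesis by (simp only: R_def)
  qed
  then show ?thesis unfolding maximal_sieve_bound_def by blast
qed

lemma maximal_sieve_bound_nonneg:
  assumes "N \<ge> 2" "maximal_sieve_bound N D"
  shows "D \<ge> 0"
proof -
  let ?a = "\<lambda>n::nat. 1 :: complex"
  have "1 \<in> {n. n \<in> {1..N-1} \<and> coprime n N}" using assms by auto
  then have "(\<Sum>n | n \<in> {1..N-1} \<and> coprime n N. (norm (?a n))\<^sup>2) > 0"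
    by (intro sum_pos) auto
  then have pos: "sqrt (\<Sum>n | n \<in> {1..N-1} \<and> coprime n N. (norm (?a n))\<^sup>2) > 0" by simp
  have "0 \<le> sqrt (1 / real (totient N) * (\<Sum>\<psi> | dirichlet_character N \<psi>. \<bar>max_char_sum N ?a \<psi>\<bar>\<^sup>2))"
    by (simp add: sum_nonneg)
  also have "\<dots> \<le> D * sqrt (\<Sum>n | n \<in> {1..N-1} \<and> coprime n N. (norm (?a n))\<^sup>2)"
    using assms(2) unfolding maximal_sieve_bound_def by blast
  finally show ?thesis using pos by (meson mult_neg_pos not_le)
qed

lemma Delta_properties:
  assumes "N \<ge> 2"
  shows maximal_sieve_bound_Delta: "maximal_sieve_bound N (Delta N)"
    and Delta_le: "maximal_sieve_bound N D \<Longrightarrow> Delta N \<le> D"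
proof -
  let ?A = "{D. maximal_sieve_bound N D}"
  have "closed ?A"
    unfolding maximal_sieve_bound_def
    by (intro closed_Collect_all closed_Collect_le continuous_intros)
  moreover have ne: "?A \<noteq> {}" using maximal_sieve_bound_exists[OF assms] by auto
  moreover have bdd: "bdd_below ?A"
    using maximal_sieve_bound_nonneg[OF assms] by (intro bdd_belowI[of _ 0]) auto
  ultimately have mem: "Inf ?A \<in> ?A" by (intro closed_contains_Inf)
  have low: "Inf ?A \<le> D" if "maximal_sieve_bound N D" for D
    using that bdd by (intro cInf_lower) auto
  have eq: "Delta N = Inf ?A"
    unfolding Delta_def using mem low by (intro Least_equality) auto
  show "maximal_sieve_bound N (Delta N)" using mem eq by simp
  show "maximal_sieve_bound N D \<Longrightarrow> Delta N \<le> D" using low eq by simp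
qed

definition positive_relative_density_in_primes :: "nat set \<Rightarrow> bool" where
  "positive_relative_density_in_primes S \<longleftrightarrow>
     Liminf at_top (\<lambda>X::real. ereal (real (card {p \<in> S. real p \<le> X}) /
                                     real (card {p::nat. prime p \<and> real p \<le> X}))) > 0"

end

theory Submission
  imports Defs
begin

text \<open>
  For a base \<open>Q\<close> and \<open>Q ^ L < p\<close>, the values \<open>\<chi> Q\<close> at the characters \<open>\<chi>\<close> modulo \<open>p\<close> behave like a uniform
  point \<open>z\<close> of the unit circle as far as powers \<open>z ^ t\<close> with \<open>t \<le> L\<close> are concerned. Multiplying the
  residues \<open>Q ^ t\<close> by a suitable \<open>n\<close>, the leading base \<open>Q\<close> digits of \<open>n / p\<close> being free, arranges
  \<open>n * Q ^ t mod p\<close> in any prescribed order. Hence \<open>Delta p\<close> bounds the maximal partial sums of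
  arbitrarily rearranged trigonometric polynomials of length about \<open>ln p / ln ln p\<close>.

  A rearrangement with large partial sums comes from the Haar system: listing the nodes of a
  binary tree of height \<open>m\<close> in order, the partial sum stopped at a point \<open>x\<close> consists of the terms negative
  at \<open>x\<close>, which makes it of order \<open>m\<close>, against an \<open>L\<^sup>2\<close> norm of order \<open>\<surd>m\<close>. The Haar functions
  are replaced by Riesz-type products of polynomial approximations to the sign of a
  cosine. The spectra of the products can be made disjoint with frequencies of size \<open>exp (O(m\<^sup>2))\<close>, so
  \<open>m\<close> may be of order \<open>(ln ln p) powr (1/2)\<close>, giving \<open>Delta p\<close> of order at least \<open>\<surd>m\<close>. This works
  for every large prime.
\<close>

section \<open>Characters modulo a prime and rearranged exponentials\<close>

text \<open>A primitive root \<open>g\<close> turns the units modulo \<open>p\<close> into exponents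
  modulo \<open>p - 1\<close>. The \<open>k\<close>-th character sends \<open>g ^ i\<close> to
  \<open>w ^ (k * i)\<close>, with \<open>w\<close> a primitive root of unity of order
  \<open>p - 1\<close>, so the sum over \<open>k\<close> is geometric.\<close>

lemma obtain_dirichlet_characters_prime:
  fixes p :: nat
  assumes "prime p"
  obtains \<psi> :: "nat \<Rightarrow> int \<Rightarrow> complex" where
    "\<And>k. dirichlet_character p (\<psi> k)"
    "inj_on \<psi> {..<p - 1}"
    "\<And>n. coprime n p \<Longrightarrow> \<not> [n = 1] (mod p) \<Longrightarrow> (\<Sum>k<p - 1. \<psi> k (int n)) = 0"
proof -
  have p: "p > 1" "p > 0" using assms prime_gt_1_nat by (auto intro: prime_gt_0_nat)
  have tot: "totient p = p - 1" using assms by (rule totient_prime)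
  have "\<exists>g. residue_primroot p g"
    using assms prime_gt_1_nat[OF assms]
    by (subst residue_primroot_iff_Carmichael) (simp add: Carmichael_prime totient_prime)
  then obtain g where g: "residue_primroot p g" by blast
  then have ord: "ord p g = p - 1" and cop: "coprime p g" by (auto simp: residue_primroot_def tot)
  have bij: "bij_betw (\<lambda>i. g ^ i mod p) {..<p - 1} (totatives p)"
    using residue_primroot_is_generator[OF p(1) g] tot by simp
  have ex: "\<exists>i<p - 1. [int (g ^ i) = n] (mod int p)" if "coprime n (int p)" for n
  proof -
    have "coprime (nat (n mod int p)) p"
      using that p by (metis coprime_int_iff coprime_mod_left_iff int_nat_eq of_nat_0_less_iff
          order_less_irrefl pos_mod_sign)
    moreover have "nat (n mod int p) < p" using p by (simp add: nat_less_iff)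
    moreover have "nat (n mod int p) \<noteq> 0"
      using calculation(1) p by (metis coprime_0_left_iff nat_dvd_1_iff_1 order_less_irrefl)
    ultimately have "nat (n mod int p) \<in> totatives p"
      by (simp add: totatives_def)
    then have "nat (n mod int p) \<in> (\<lambda>i. g ^ i mod p) ` {..<p - 1}"
      using bij by (simp only: bij_betw_def)
    then obtain i where i: "i < p - 1" "g ^ i mod p = nat (n mod int p)"
      by (elim imageE) simp
    then have "int (g ^ i mod p) = n mod int p" using p by simp
    then show ?thesis using i(1) by (auto simp: cong_def zmod_int)
  qed
  define ind where "ind n = (SOME i. i < p - 1 \<and> [int (g ^ i) = n] (mod int p))" for n
  have ind: "ind n < p - 1" "[int (g ^ ind n) = n] (mod int p)" if "coprime n (int p)" for n
    using someI_ex[OF ex[OF that]] unfolding ind_def by auto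
  define w where "w = cis (2 * pi / real (p - 1))"
  have w0: "w \<noteq> 0" by (simp add: w_def)
  have wpow: "w ^ i = cis (2 * pi * real i / real (p - 1))" for i
    unfolding w_def Complex.DeMoivre by (simp add: mult.commute)
  have winj: "inj_on (\<lambda>i. w ^ i) {..<p - 1}"
    using Complex.bij_betw_roots_unity[of "p - 1"] p by (simp add: wpow bij_betw_def)
  have w1: "w ^ (p - 1) = 1" using p by (simp add: wpow)
  have wmod: "w ^ i = w ^ j" if "[i = j] (mod (p - 1))" for i j
  proof -
    have "w ^ i = w ^ (i mod (p - 1))" for i
      by (metis div_mult_mod_eq mult.commute mult_1 power_add power_mult power_one w1)
    then show ?thesis using that by (metis cong_def)
  qed
  have indcong: "[ind n = i] (mod (p - 1))" if "[int (g ^ i) = n] (mod int p)" for n i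
  proof -
    have "coprime n (int p)"
    proof -
      have "coprime (int (g ^ i)) (int p)" using cop by (simp add: coprime_commute)
      then show ?thesis using that cong_imp_coprime by blast
    qed
    then have "[int (g ^ ind n) = int (g ^ i)] (mod int p)"
      using ind(2) that cong_sym cong_trans by blast
    then have "[g ^ ind n = g ^ i] (mod p)" using cong_int_iff by blast
    then show ?thesis using order_divides_expdiff[OF cop] ord by simp
  qed
  define \<psi> where "\<psi> k n = (if coprime n (int p) then w ^ (k * ind n) else 0)" for k n
  show thesis
  proof
    show "dirichlet_character p (\<psi> k)" for k
      unfolding dirichlet_character_def
    proof (intro conjI allI)
      fix m n :: int
      show "\<psi> k (m * n) = \<psi> k m * \<psi> k n"
      proof (cases "coprime m (int p) \<and> coprime n (int p)")
        case True
        then have "[int (g ^ (ind m + ind n)) = m * n] (mod int p)"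
          using ind(2)[of m] ind(2)[of n] by (simp add: power_add cong_mult)
        then have "[k * ind (m * n) = k * (ind m + ind n)] (mod (p - 1))"
          by (intro cong_mult indcong) auto
        from wmod[OF this] True show ?thesis by (simp add: \<psi>_def algebra_simps power_add)
      qed (auto simp: \<psi>_def)
    next
      fix n :: int
      have c: "coprime (n + int p) (int p) \<longleftrightarrow> coprime n (int p)"
        by (simp add: coprime_iff_gcd_eq_1)
      show "\<psi> k (n + int p) = \<psi> k n"
      proof (cases "coprime n (int p)")
        case True
        have "[int (g ^ ind n) = n + int p] (mod int p)"
          using ind(2)[OF True] by (simp add: cong_def)
        then have "[k * ind (n + int p) = k * ind n] (mod (p - 1))"
          by (intro cong_mult indcong) auto
        from wmod[OF this] c True show ?thesis by (simp add: \<psi>_def)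
      qed (use c in \<open>simp add: \<psi>_def\<close>)
    next
      fix n :: int
      show "(\<psi> k n \<noteq> 0) = coprime n (int p)" using w0 by (simp add: \<psi>_def)
    qed
    show "inj_on \<psi> {..<p - 1}"
    proof (rule inj_onI)
      fix k l assume kl: "k \<in> {..<p - 1}" "l \<in> {..<p - 1}" "\<psi> k = \<psi> l"
      have cg: "coprime (int g) (int p)" using cop by (simp add: coprime_commute)
      have "[ind (int g) = 1] (mod (p - 1))" by (intro indcong) auto
      then have "[k * ind (int g) = k] (mod (p - 1))" for k
        using cong_scalar_left by fastforce
      then have "\<psi> k (int g) = w ^ k" for k using wmod cg by (simp add: \<psi>_def)
      then have "w ^ k = w ^ l" using kl(3) by metis
      then show "k = l" using winj kl(1,2) by (auto dest: inj_onD)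
    qed
    show "(\<Sum>k<p - 1. \<psi> k (int n)) = 0" if n: "coprime n p" "\<not> [n = 1] (mod p)" for n
    proof -
      have cn: "coprime (int n) (int p)" using n by simp
      define y where "y = w ^ ind (int n)"
      have "ind (int n) \<noteq> 0"
      proof
        assume "ind (int n) = 0"
        then have "[1 = int n] (mod int p)" using ind(2)[OF cn] by simp
        then show False using n(2) by (metis cong_int_iff cong_sym of_nat_1)
      qed
      then have y1: "y \<noteq> 1"
        using inj_onD[OF winj, of "ind (int n)" 0] ind(1)[OF cn] p by (auto simp: y_def)
      have "y ^ (p - 1) = 1"
        unfolding y_def by (metis mult.commute power_mult power_one w1)
      then have "(\<Sum>k<p - 1. y ^ k) = 0" using geometric_sum[OF y1, of "p - 1"] by simp
      moreover have "\<psi> k (int n) = y ^ k" for k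
        using cn by (simp add: \<psi>_def y_def mult.commute flip: power_mult)
      ultimately show ?thesis by simp
    qed
  qed
qed

text \<open>
  Choosing \<open>n / p\<close> close to the number with base \<open>Q\<close> expansion \<open>0.d\<^sub>0 d\<^sub>1 d\<^sub>2 \<dots>\<close> places
  \<open>n * Q ^ t mod p\<close> in the interval of \<open>[0, p)\<close> prescribed by \<open>d t\<close>.
\<close>

lemma obtain_residues_with_leading_digits:
  fixes p Q L :: nat and d :: "nat \<Rightarrow> nat"
  assumes Q: "Q \<ge> 2" and p: "Q ^ Suc L \<le> p" and d: "\<And>t. t < L \<Longrightarrow> d t + 2 \<le> Q"
  obtains n where "\<And>t. t < L \<Longrightarrow> d t * p \<le> Q * (n * Q ^ t mod p)"
    "\<And>t. t < L \<Longrightarrow> Q * (n * Q ^ t mod p) < (d t + 1) * p"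
proof -
  \<comment> \<open>\<open>Y u\<close> is the integer formed by the last \<open>u\<close> of the
    base \<open>Q\<close> digits \<open>d 0, ..., d (L - 1)\<close>. As no digit exceeds
    \<open>Q - 2\<close>, it stays at least \<open>Q ^ u / Q\<close> below \<open>Q ^ u\<close>,
    which leaves room for a rounding error.\<close>
  define Y where "Y u = (\<Sum>i<u. d (L - 1 - i) * Q ^ i)" for u
  have Y_le: "Q * Y u \<le> (Q - 1) * Q ^ u" if "u \<le> L" for u
    using that
  proof (induction u)
    case (Suc u)
    have "d (L - 1 - u) \<le> Q - 2" using d[of "L - 1 - u"] Suc.prems by simp
    then have "Q * (d (L - 1 - u) * Q ^ u) \<le> Q * ((Q - 2) * Q ^ u)"
      by (intro mult_left_mono mult_right_mono) auto
    moreover have "Q * Y u \<le> (Q - 1) * Q ^ u" using Suc by simp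
    moreover have "Y (Suc u) = Y u + d (L - 1 - u) * Q ^ u" by (simp add: Y_def)
    moreover obtain R where R: "Q = R + 2" using Q by (metis add.commute le_Suc_ex)
    have "Q * ((Q - 2) * Q ^ u) + (Q - 1) * Q ^ u \<le> (Q - 1) * Q ^ Suc u"
      by (simp add: R algebra_simps)
    ultimately show ?case by (simp only: distrib_left)
  qed (simp add: Y_def)
  have Y_split: "\<exists>c. Y L = c * Q ^ u + Y u" if "u \<le> L" for u
  proof -
    have "Y L = (\<Sum>i\<in>{u..<L}. d (L - 1 - i) * Q ^ i) + Y u"
      using that sum.atLeastLessThan_concat[of 0 u L "\<lambda>i. d (L - 1 - i) * Q ^ i"]
      by (simp add: Y_def lessThan_atLeast0)
    moreover have "Q ^ u dvd (\<Sum>i\<in>{u..<L}. d (L - 1 - i) * Q ^ i)"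
      by (intro dvd_sum dvd_mult le_imp_power_dvd) auto
    ultimately show ?thesis by (metis dvd_def mult.commute)
  qed
  \<comment> \<open>\<open>n\<close> is \<open>p * Y L / Q ^ L\<close> rounded up, and
    \<open>\<rho>\<close> measures the excess.\<close>
  define n where "n = (p * Y L + (Q ^ L - 1)) div Q ^ L"
  define \<rho> where "\<rho> = n * Q ^ L - p * Y L"
  have QL: "Q ^ L > 0" using Q by simp
  have n: "n * Q ^ L = p * Y L + \<rho>" "\<rho> < Q ^ L"
  proof -
    define x where "x = p * Y L + (Q ^ L - 1)"
    have "n * Q ^ L = x - x mod Q ^ L" by (simp add: n_def x_def minus_mod_eq_div_mult)
    moreover have "x mod Q ^ L < Q ^ L" "x mod Q ^ L \<le> x" using QL by auto
    moreover have "x + 1 = p * Y L + Q ^ L" using QL by (simp add: x_def)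
    ultimately have "p * Y L \<le> n * Q ^ L \<and> n * Q ^ L < p * Y L + Q ^ L"
      by linarith
    then show "n * Q ^ L = p * Y L + \<rho>" "\<rho> < Q ^ L" unfolding \<rho>_def by auto
  qed
  have main: "d t * p \<le> Q * (n * Q ^ t mod p) \<and> Q * (n * Q ^ t mod p) < (d t + 1) * p"
    if t: "t < L" for t
  proof -
    \<comment> \<open>Multiplication by \<open>Q ^ t\<close> moves the leading \<open>t\<close>
      digits into the integer \<open>c\<close>, and \<open>p * c\<close> vanishes modulo
      \<open>p\<close>. The remainder \<open>v\<close> begins with the digit \<open>d t\<close>; as
      \<open>Q * \<rho> < p\<close>, the rounding error causes no carry.\<close>
    define u where "u = L - Suc t"
    have tu: "t + Suc u = L" using t by (simp add: u_def)
    then have Su: "Suc u \<le> L" "Q ^ t * Q ^ Suc u = Q ^ L" "L - 1 - u = t"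
      by (simp, metis power_add, simp add: u_def)
    obtain c where c: "Y L = c * Q ^ Suc u + Y (Suc u)" using Y_split[OF Su(1)] by blast
    have e1: "(n * Q ^ t) * Q ^ Suc u = (p * c) * Q ^ Suc u + (p * Y (Suc u) + \<rho>)"
      using n(1) c Su(2) by (simp add: algebra_simps)
    define v where "v = n * Q ^ t - p * c"
    have "(p * c) * Q ^ Suc u \<le> (n * Q ^ t) * Q ^ Suc u" using e1 by simp
    then have "p * c \<le> n * Q ^ t" using Q by (subst (asm) mult_le_cancel2) simp
    then have v1: "n * Q ^ t = p * c + v" by (simp add: v_def)
    have v2: "v * Q ^ Suc u = p * Y (Suc u) + \<rho>" using e1 unfolding v1 by (simp add: algebra_simps)
    have Yu: "Y (Suc u) = Y u + d t * Q ^ u" using Su(3) by (simp add: Y_def)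
    have v3: "Q * v * Q ^ u = p * Y u + p * d t * Q ^ u + \<rho>"
      using v2 Yu by (simp add: algebra_simps)
    have lo: "d t * p \<le> Q * v"
    proof -
      have "d t * p * Q ^ u \<le> Q * v * Q ^ u" using v3 by (simp add: algebra_simps)
      then show ?thesis using Q by (subst (asm) mult_le_cancel2) simp
    qed
    have hi: "Q * v < (d t + 1) * p"
    proof -
      have "Q * \<rho> < Q * Q ^ L" using n(2) Q by simp
      also have "\<dots> \<le> p" using p by simp
      also have "\<dots> \<le> p * Q ^ u" using Q by simp
      finally have "Q * \<rho> < p * Q ^ u" .
      moreover have "p * (Q * Y u) \<le> p * ((Q - 1) * Q ^ u)"
        using Y_le[of u] Su(1) by (intro mult_left_mono) auto
      moreover have "p * ((Q - 1) * Q ^ u) + p * Q ^ u = Q * (p * Q ^ u)"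
        using Q by (cases Q) (simp_all add: algebra_simps)
      ultimately have "Q * (p * Y u + \<rho>) < Q * (p * Q ^ u)" by (simp add: algebra_simps)
      then have "p * Y u + \<rho> < p * Q ^ u" by simp
      then have "Q * v * Q ^ u < (d t + 1) * p * Q ^ u" using v3 by (simp add: algebra_simps)
      then show ?thesis by simp
    qed
    have "(d t + 1) * p \<le> Q * p" using d[OF t] by (intro mult_right_mono) auto
    then have "Q * v < Q * p" using hi by linarith
    then have "v < p" by simp
    then have "n * Q ^ t mod p = v" using v1 by simp
    then show ?thesis using lo hi by simp
  qed
  show thesis using that[of n] main by blast
qed

section \<open>Partial sums of characters and \<open>Delta\<close>\<close>

lemma norm_dirichlet_character_eq_1:
  assumes "dirichlet_character N \<psi>" "N > 0" "coprime n (int N)"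
  shows "norm (\<psi> n) = 1"
proof -
  have "norm (\<psi> n) ^ totient N = 1"
    using dirichlet_character_root_of_unity[OF assms] by (metis norm_one norm_power)
  then show ?thesis
    using assms(2) by (metis norm_ge_zero power_eq_1_iff totient_gt_0_iff abs_of_nonneg neq0_conv
        real_norm_def)
qed

text \<open>The cut \<open>l k\<close> may depend on the character because
  \<open>max_char_sum\<close> dominates every partial sum. Restriction to the characters
  \<open>\<psi> k\<close> only drops nonnegative terms.\<close>

lemma sum_norm_char_sum_le_Delta:
  assumes "prime p" "p \<ge> 2"
    and "inj_on \<psi> {..<p - 1}" "\<And>k. k < p - 1 \<Longrightarrow> dirichlet_character p (\<psi> k)"
    and "\<And>k. k < p - 1 \<Longrightarrow> l k \<in> {1..<p}"
  shows "(\<Sum>k<p - 1. (norm (\<Sum>n\<in>{1..l k}. a n * \<psi> k (int n)))\<^sup>2) / real (p - 1)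
    \<le> (Delta p)\<^sup>2 * (\<Sum>n\<in>{1..<p}. (norm (a n))\<^sup>2)"
proof -
  have cop: "coprime n p" if "n \<in> {1..<p}" for n
    using that assms(1) by (metis atLeastLessThan_iff coprime_commute nat_dvd_not_less
        prime_imp_coprime zero_less_one order_less_le_trans)
  have set1: "{n. n \<in> {1..l} \<and> coprime n p} = {1..l}" if "l < p" for l
    using that cop by auto
  have set2: "{n. n \<in> {1..p - 1} \<and> coprime n p} = {1..<p}" using cop by auto
  have fin: "finite {\<psi>. dirichlet_character p \<psi>}"
    using assms(2) by (intro finite_dirichlet_characters) simp
  let ?M = "max_char_sum p a"
  have M: "norm (\<Sum>n\<in>{1..l k}. a n * \<psi> k (int n)) \<le> ?M (\<psi> k)" if "k < p - 1" for k
  proof -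
    have "norm (\<Sum>n | n \<in> {1..l k} \<and> coprime n p. a n * \<psi> k (int n)) \<le> ?M (\<psi> k)"
      unfolding max_char_sum_def by (rule Max_ge) (use assms(5)[OF that] in auto)
    then show ?thesis using set1[of "l k"] assms(5)[OF that] by simp
  qed
  have "(\<Sum>k<p - 1. (norm (\<Sum>n\<in>{1..l k}. a n * \<psi> k (int n)))\<^sup>2) \<le> (\<Sum>k<p - 1. \<bar>?M (\<psi> k)\<bar>\<^sup>2)"
    using M by (intro sum_mono) (simp add: power_mono)
  also have "\<dots> = (\<Sum>\<xi>\<in>\<psi> ` {..<p - 1}. \<bar>?M \<xi>\<bar>\<^sup>2)"
    using assms(3) by (simp add: sum.reindex)
  also have "\<dots> \<le> (\<Sum>\<xi> | dirichlet_character p \<xi>. \<bar>?M \<xi>\<bar>\<^sup>2)"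
    using fin assms(4) by (intro sum_mono2) auto
  finally have le: "(\<Sum>k<p - 1. (norm (\<Sum>n\<in>{1..l k}. a n * \<psi> k (int n)))\<^sup>2) / real (p - 1)
    \<le> 1 / real (totient p) * (\<Sum>\<xi> | dirichlet_character p \<xi>. \<bar>?M \<xi>\<bar>\<^sup>2)"
    using assms(1) by (simp add: totient_prime divide_right_mono)
  have "sqrt (1 / real (totient p) * (\<Sum>\<xi> | dirichlet_character p \<xi>. \<bar>?M \<xi>\<bar>\<^sup>2))
    \<le> Delta p * sqrt (\<Sum>n\<in>{1..<p}. (norm (a n))\<^sup>2)"
    using maximal_sieve_bound_Delta[OF assms(2)] set2 unfolding maximal_sieve_bound_def by metis
  then have "1 / real (totient p) * (\<Sum>\<xi> | dirichlet_character p \<xi>. \<bar>?M \<xi>\<bar>\<^sup>2)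
    \<le> (Delta p * sqrt (\<Sum>n\<in>{1..<p}. (norm (a n))\<^sup>2))\<^sup>2"
    by (rule sqrt_le_D)
  also have "\<dots> = (Delta p)\<^sup>2 * (\<Sum>n\<in>{1..<p}. (norm (a n))\<^sup>2)"
    by (simp add: power_mult_distrib sum_nonneg)
  finally show ?thesis using le by (rule order_trans[rotated])
qed

text \<open>\<open>Z k\<close> is the value of the \<open>k\<close>-th character at
  \<open>Q\<close>; orthogonality kills its powers because \<open>1 < Q ^ t < p\<close>. The
  coefficient \<open>c t\<close> is placed at the residue \<open>n * Q ^ t mod p\<close> with
  leading digit \<open>d t\<close>, so an initial segment of residues retains exactly the
  \<open>t\<close> with \<open>d t \<le> x k\<close>.\<close>

lemma obtain_rearranged_exponentials:
  fixes p Q L :: nat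
  assumes p: "prime p" and Q: "Q \<ge> 2" and pQ: "Q ^ Suc L \<le> p" and L: "L \<ge> 1"
  obtains Z :: "nat \<Rightarrow> complex" where
    "\<And>k. norm (Z k) = 1"
    "\<And>t. 0 < t \<Longrightarrow> t \<le> L \<Longrightarrow> (\<Sum>k<p - 1. Z k ^ t) = 0"
    "\<And>c d x. (\<And>t. t < L \<Longrightarrow> 1 \<le> d t \<and> d t + 2 \<le> Q) \<Longrightarrow> (\<And>k. k < p - 1 \<Longrightarrow> x k < Q - 1) \<Longrightarrow>
      (\<Sum>k<p - 1. (norm (\<Sum>t | t < L \<and> d t \<le> x k. c t * Z k ^ t))\<^sup>2) / real (p - 1)
      \<le> (Delta p)\<^sup>2 * (\<Sum>t<L. (norm (c t))\<^sup>2)"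
proof -
  obtain \<psi> where \<psi>: "\<And>k. dirichlet_character p (\<psi> k)" "inj_on \<psi> {..<p - 1}"
    "\<And>n. coprime n p \<Longrightarrow> \<not> [n = 1] (mod p) \<Longrightarrow> (\<Sum>k<p - 1. \<psi> k (int n)) = 0"
    using obtain_dirichlet_characters_prime[OF p] by metis
  have p2: "p \<ge> 2" using p by (rule prime_ge_2_nat)
  have mult: "\<psi> k (x * y) = \<psi> k x * \<psi> k y" for k x y
    using \<psi>(1)[of k] by (simp add: dirichlet_character_def)
  have nz: "\<psi> k n \<noteq> 0 \<longleftrightarrow> coprime n (int p)" for k n
    using \<psi>(1)[of k] by (simp add: dirichlet_character_def)
  have one: "\<psi> k 1 = 1" for k using mult[of k 1 1] nz[of k 1] by simp
  have pow: "\<psi> k (x ^ t) = \<psi> k x ^ t" for k x t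
    by (induction t) (simp_all add: one mult)
  have Q0: "Q > 0" using Q by simp
  have Qpow: "1 < Q ^ t \<and> Q ^ t < p" if "0 < t" "t \<le> L" for t
  proof -
    have "Q ^ t < Q ^ Suc L" using that Q by (intro power_strict_increasing) auto
    moreover have "1 < Q ^ t" using that Q by (intro one_less_power) auto
    ultimately show ?thesis using pQ by linarith
  qed
  have Qp: "Q < p" using Qpow[of 1] L by simp
  have copQ: "coprime Q p"
    using p Qp Q by (metis coprime_commute nat_dvd_not_less not_numeral_le_zero gr0I prime_imp_coprime)
  have not1: "\<not> [Q ^ t = 1] (mod p)" if "0 < t" "t \<le> L" for t
    using Qpow[OF that] by (simp only: cong_def) (metis less_trans mod_less order_less_irrefl)
  define Z where "Z k = \<psi> k (int Q)" for k
  show thesis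
  proof (rule that[of Z])
    show "norm (Z k) = 1" for k
      using norm_dirichlet_character_eq_1[OF \<psi>(1)] copQ p2 by (simp add: Z_def)
    show "(\<Sum>k<p - 1. Z k ^ t) = 0" if "0 < t" "t \<le> L" for t
      using \<psi>(3)[of "Q ^ t"] not1[OF that] copQ by (simp add: Z_def flip: pow)
  next
    fix c :: "nat \<Rightarrow> complex" and d x :: "nat \<Rightarrow> nat"
    assume d: "\<And>t. t < L \<Longrightarrow> 1 \<le> d t \<and> d t + 2 \<le> Q" and x: "\<And>k. k < p - 1 \<Longrightarrow> x k < Q - 1"
    have d1: "1 \<le> d t" and d2: "d t + 2 \<le> Q" if "t < L" for t
      using d[OF that] by auto
    obtain n where n: "\<And>t. t < L \<Longrightarrow> d t * p \<le> Q * (n * Q ^ t mod p)"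
      "\<And>t. t < L \<Longrightarrow> Q * (n * Q ^ t mod p) < (d t + 1) * p"
      using obtain_residues_with_leading_digits[OF Q pQ, of d] d2 by metis
    define v where "v t = n * Q ^ t mod p" for t
    have v: "v t \<in> {1..<p}" if "t < L" for t
    proof -
      have "0 < d t * p" using d1[OF that] p2 by simp
      also have "\<dots> \<le> Q * v t" using n(1)[OF that] by (simp add: v_def)
      finally have "v t > 0" by simp
      moreover have "v t < p" using p2 by (simp add: v_def)
      ultimately show ?thesis by simp
    qed
    have copn: "coprime n p"
    proof -
      have "v 0 \<noteq> 0" using v[of 0] L by simp
      then have "\<not> p dvd n" by (auto simp: v_def)
      then show ?thesis using p by (metis coprime_commute prime_imp_coprime)
    qed
    have inj: "inj_on v {..<L}"
    proof (rule linorder_inj_onI)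
      fix s t assume st: "s < t" "s \<in> {..<L}" "t \<in> {..<L}"
      show "v s \<noteq> v t"
      proof
        assume "v s = v t"
        then have "[n * Q ^ s * Q ^ (t - s) = n * Q ^ s * 1] (mod p)"
          using st by (simp add: v_def cong_def mult.assoc flip: power_add)
        moreover have "coprime (n * Q ^ s) p" using copn copQ by simp
        ultimately have "[Q ^ (t - s) = 1] (mod p)" using cong_mult_lcancel_nat by blast
        moreover have "0 < t - s" "t - s \<le> L" using st by auto
        ultimately show False using not1[of "t - s"] by simp
      qed
    qed auto
    define a where "a r = (if r \<in> v ` {..<L} then c (the_inv_into {..<L} v r) else 0)" for r
    have av: "a (v t) = c t" if "t < L" for t
      using that inj by (simp add: a_def the_inv_into_f_f)
    have a0: "a r = 0" if "r \<notin> v ` {..<L}" for r using that by (simp add: a_def)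
    \<comment> \<open>The last \<open>r\<close> with leading digit at most \<open>x k\<close>, that
      is, with \<open>r * Q < (x k + 1) * p\<close>; the \<open>- 1\<close> makes this inequality
      strict.\<close>
    define l where "l k = ((x k + 1) * p - 1) div Q" for k
    have l_iff: "r \<le> l k \<longleftrightarrow> r * Q < (x k + 1) * p" for r k
    proof -
      have "(x k + 1) * p > 0" using p2 by simp
      then show ?thesis unfolding l_def using Q0 less_eq_div_iff_mult_less_eq[OF Q0] by auto
    qed
    have v_le: "v t \<le> l k \<longleftrightarrow> d t \<le> x k" if t: "t < L" for t k
    proof
      assume "v t \<le> l k"
      then have "v t * Q < (x k + 1) * p" by (simp only: l_iff)
      then have "d t * p < (x k + 1) * p" using n(1)[OF t] by (simp add: v_def mult.commute)
      then have "d t < x k + 1" by (simp only: mult_less_cancel2)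
      then show "d t \<le> x k" by simp
    next
      assume "d t \<le> x k"
      then have "(d t + 1) * p \<le> (x k + 1) * p" by (intro mult_right_mono) auto
      moreover have "v t * Q < (d t + 1) * p" using n(2)[OF t] by (simp only: v_def mult.commute)
      ultimately have "v t * Q < (x k + 1) * p" by linarith
      then show "v t \<le> l k" by (simp only: l_iff)
    qed
    have l: "l k \<in> {1..<p}" if "k < p - 1" for k
    proof -
      have "1 \<le> l k" using Qp by (simp add: l_iff)
      moreover have "\<not> p \<le> l k"
      proof -
        have "x k + 1 \<le> Q" using x[OF that] by simp
        then have "(x k + 1) * p \<le> Q * p" by (rule mult_right_mono) simp
        then have "(x k + 1) * p \<le> p * Q" by (simp only: mult.commute)
        then show ?thesis by (simp only: l_iff not_less)
      qed
      ultimately show ?thesis by simp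
    qed
    have sum1: "norm (\<Sum>r\<in>{1..l k}. a r * \<psi> k (int r)) = norm (\<Sum>t | t < L \<and> d t \<le> x k. c t * Z k ^ t)"
      for k
    proof -
      let ?T = "{t. t < L \<and> d t \<le> x k}"
      have vpow: "\<psi> k (int (v t)) = \<psi> k (int n) * Z k ^ t" for t
      proof -
        have "[int (v t) = int n * int Q ^ t] (mod int p)"
          by (simp add: v_def cong_def zmod_int)
        then have "\<psi> k (int (v t)) = \<psi> k (int n * int Q ^ t)"
          by (rule dirichlet_character_cong[OF \<psi>(1)])
        then show ?thesis by (simp add: mult pow Z_def)
      qed
      have "(\<Sum>r\<in>{1..l k}. a r * \<psi> k (int r)) = (\<Sum>r\<in>v ` ?T. a r * \<psi> k (int r))"
      proof (rule sum.mono_neutral_right)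
        show "v ` ?T \<subseteq> {1..l k}" using v v_le by fastforce
        show "\<forall>r\<in>{1..l k} - v ` ?T. a r * \<psi> k (int r) = 0"
        proof
          fix r assume r: "r \<in> {1..l k} - v ` ?T"
          have "r \<notin> v ` {..<L}" using r v_le by fastforce
          then show "a r * \<psi> k (int r) = 0" by (simp add: a0)
        qed
      qed simp
      also have "\<dots> = (\<Sum>t\<in>?T. a (v t) * \<psi> k (int (v t)))"
        using inj by (subst sum.reindex) (auto simp: inj_on_def)
      also have "\<dots> = (\<Sum>t\<in>?T. \<psi> k (int n) * (c t * Z k ^ t))"
        by (intro sum.cong) (simp_all add: av vpow)
      also have "\<dots> = \<psi> k (int n) * (\<Sum>t\<in>?T. c t * Z k ^ t)" by (simp add: sum_distrib_left)
      finally show ?thesis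
        using norm_dirichlet_character_eq_1[OF \<psi>(1), of "int n"] copn p2 by (simp add: norm_mult)
    qed
    have sum2: "(\<Sum>r\<in>{1..<p}. (norm (a r))\<^sup>2) = (\<Sum>t<L. (norm (c t))\<^sup>2)"
    proof -
      have "(\<Sum>r\<in>{1..<p}. (norm (a r))\<^sup>2) = (\<Sum>r\<in>v ` {..<L}. (norm (a r))\<^sup>2)"
        using v by (intro sum.mono_neutral_right) (auto simp: a0)
      then show ?thesis using inj by (simp add: sum.reindex av)
    qed
    show "(\<Sum>k<p - 1. (norm (\<Sum>t | t < L \<and> d t \<le> x k. c t * Z k ^ t))\<^sup>2) / real (p - 1)
      \<le> (Delta p)\<^sup>2 * (\<Sum>t<L. (norm (c t))\<^sup>2)"
      using sum_norm_char_sum_le_Delta[of p \<psi> l a] p p2 \<psi>(1,2) l unfolding sum1 sum2 by blast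
  qed
qed

section \<open>Trigonometric polynomials sampled at finitely many points\<close>

text \<open>\<open>S\<close> only has to contain the spectrum, and the identity is demanded on the
  unit circle alone; hence \<open>Re\<close> qualifies, being \<open>(z + inverse z) / 2\<close>
  there.\<close>

definition trig_poly :: "int set \<Rightarrow> (complex \<Rightarrow> real) \<Rightarrow> bool" where
  "trig_poly S F \<longleftrightarrow> finite S \<and>
     (\<exists>c. \<forall>z. norm z = 1 \<longrightarrow> complex_of_real (F z) = (\<Sum>t\<in>S. c t * z powi t))"

lemma trig_polyI:
  assumes "finite S" "\<And>z. norm z = 1 \<Longrightarrow> complex_of_real (F z) = (\<Sum>t\<in>S. c t * z powi t)"
  shows "trig_poly S F"
  using assms unfolding trig_poly_def by blast

lemma trig_polyE:
  assumes "trig_poly S F"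
  obtains c where "\<And>z. norm z = 1 \<Longrightarrow> complex_of_real (F z) = (\<Sum>t\<in>S. c t * z powi t)"
  using assms unfolding trig_poly_def by blast

lemma trig_poly_finite: "trig_poly S F \<Longrightarrow> finite S"
  by (simp add: trig_poly_def)

lemma trig_poly_mono:
  assumes "trig_poly S F" "S \<subseteq> T" "finite T"
  shows "trig_poly T F"
proof -
  obtain c where c: "\<And>z. norm z = 1 \<Longrightarrow> complex_of_real (F z) = (\<Sum>t\<in>S. c t * z powi t)"
    using assms(1) by (rule trig_polyE) blast
  show ?thesis
  proof (rule trig_polyI)
    fix z :: complex assume z: "norm z = 1"
    show "complex_of_real (F z) = (\<Sum>t\<in>T. (if t \<in> S then c t else 0) * z powi t)"
      using assms(2,3) by (simp add: c[OF z] if_distrib[of "\<lambda>x. x * _"] sum.If_cases Int_absorb1 cong: if_cong)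
  qed fact
qed

lemma trig_poly_const: "finite S \<Longrightarrow> 0 \<in> S \<Longrightarrow> trig_poly S (\<lambda>z. a)"
  by (rule trig_poly_mono[of "{0}"], rule trig_polyI[where c = "\<lambda>_. complex_of_real a"]) auto

lemma trig_poly_zero: "finite S \<Longrightarrow> trig_poly S (\<lambda>z. 0)"
  by (rule trig_polyI[where c = "\<lambda>_. 0"]) auto

lemma trig_poly_add:
  assumes "trig_poly S F" "trig_poly S H"
  shows "trig_poly S (\<lambda>z. F z + H z)"
proof -
  obtain c d where "\<And>z. norm z = 1 \<Longrightarrow> complex_of_real (F z) = (\<Sum>t\<in>S. c t * z powi t)"
    "\<And>z. norm z = 1 \<Longrightarrow> complex_of_real (H z) = (\<Sum>t\<in>S. d t * z powi t)"
    using assms by (metis trig_polyE)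
  then show ?thesis
    using trig_poly_finite[OF assms(1)]
    by (intro trig_polyI[where c = "\<lambda>t. c t + d t"]) (simp_all add: distrib_right sum.distrib)
qed

lemma trig_poly_cmult:
  assumes "trig_poly S F"
  shows "trig_poly S (\<lambda>z. a * F z)"
proof -
  obtain c where "\<And>z. norm z = 1 \<Longrightarrow> complex_of_real (F z) = (\<Sum>t\<in>S. c t * z powi t)"
    using assms by (metis trig_polyE)
  then show ?thesis
    using trig_poly_finite[OF assms(1)]
    by (intro trig_polyI[where c = "\<lambda>t. a * c t"]) (simp_all add: sum_distrib_left mult.assoc)
qed

lemma trig_poly_sum:
  assumes "finite S" "\<And>i. i \<in> I \<Longrightarrow> trig_poly S (F i)"
  shows "trig_poly S (\<lambda>z. \<Sum>i\<in>I. F i z)"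
proof (cases "finite I")
  case True
  then show ?thesis using assms(2)
    by (induction I) (auto intro: trig_poly_zero[OF assms(1)] trig_poly_add)
qed (simp add: trig_poly_zero assms(1))

lemma trig_poly_mult:
  assumes "trig_poly S F" "trig_poly T H" "finite U" "\<And>s t. s \<in> S \<Longrightarrow> t \<in> T \<Longrightarrow> s + t \<in> U"
  shows "trig_poly U (\<lambda>z. F z * H z)"
proof -
  obtain c d where c: "\<And>z. norm z = 1 \<Longrightarrow> complex_of_real (F z) = (\<Sum>t\<in>S. c t * z powi t)"
    and d: "\<And>z. norm z = 1 \<Longrightarrow> complex_of_real (H z) = (\<Sum>t\<in>T. d t * z powi t)"
    using assms by (metis trig_polyE)
  have fin: "finite (S \<times> T)" using assms trig_poly_finite by blast
  show ?thesis
  proof (rule trig_polyI)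
    fix z :: complex assume z: "norm z = 1"
    then have "z \<noteq> 0" by auto
    have "complex_of_real (F z * H z) = (\<Sum>(s, t)\<in>S \<times> T. c s * d t * z powi (s + t))"
      using \<open>z \<noteq> 0\<close> by (simp add: c[OF z] d[OF z] sum_product sum.cartesian_product power_int_add
          ac_simps)
    also have "\<dots> = (\<Sum>u\<in>U. \<Sum>x\<in>{x \<in> S \<times> T. fst x + snd x = u}. c (fst x) * d (snd x) * z powi u)"
      by (subst sum.group[symmetric, where g = "\<lambda>x. fst x + snd x" and T = U])
        (use fin assms(3,4) in \<open>auto intro!: sum.cong\<close>)
    finally show "complex_of_real (F z * H z) =
      (\<Sum>u\<in>U. (\<Sum>x\<in>{x \<in> S \<times> T. fst x + snd x = u}. c (fst x) * d (snd x)) * z powi u)"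
      by (simp add: sum_distrib_right)
  qed fact
qed

lemma trig_poly_power_arg:
  assumes "trig_poly S F" "l \<noteq> 0"
  shows "trig_poly ((\<lambda>e. e * l) ` S) (\<lambda>z. F (z powi l))"
proof -
  obtain c where c: "\<And>z. norm z = 1 \<Longrightarrow> complex_of_real (F z) = (\<Sum>t\<in>S. c t * z powi t)"
    using assms by (metis trig_polyE)
  have inj: "inj_on (\<lambda>e. e * l) S" using assms(2) by (auto simp: inj_on_def)
  show ?thesis
  proof (rule trig_polyI)
    fix z :: complex assume z: "norm z = 1"
    then have "norm (z powi l) = 1" by (simp add: norm_power_int)
    then have "complex_of_real (F (z powi l)) = (\<Sum>t\<in>S. c t * z powi (t * l))"
      by (simp only: c power_int_mult mult.commute[of _ l])
    then show "complex_of_real (F (z powi l)) =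
      (\<Sum>u\<in>(\<lambda>e. e * l) ` S. c (u div l) * z powi u)"
      using inj assms(2) by (simp add: sum.reindex)
  qed (use assms trig_poly_finite in blast)
qed

lemma inverse_eq_cnj: "norm z = 1 \<Longrightarrow> inverse z = cnj z"
  by (rule inverse_unique) (simp flip: complex_norm_square)

section \<open>Averages over a finite sample of the circle\<close>

locale unit_sample =
  fixes P :: nat and Z :: "nat \<Rightarrow> complex" and L :: nat
  assumes P_pos: "P > 0"
    and norm_Z: "\<And>k. norm (Z k) = 1"
    and sum_Z_power: "\<And>t. 0 < t \<Longrightarrow> t \<le> L \<Longrightarrow> (\<Sum>k<P. Z k ^ t) = 0"
begin

text \<open>Substitute for the mean over the circle: on trigonometric polynomials with spectrum in
  \<open>{- int L..int L}\<close> both give the constant coefficient.\<close>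

definition avg :: "(complex \<Rightarrow> real) \<Rightarrow> real" where
  "avg F = (\<Sum>k<P. F (Z k)) / real P"

lemma Z_nonzero [simp]: "Z k \<noteq> 0"
  using norm_Z[of k] by auto

lemma avg_cong: "(\<And>z. norm z = 1 \<Longrightarrow> F z = H z) \<Longrightarrow> avg F = avg H"
  by (simp add: avg_def norm_Z)

lemma avg_add: "avg (\<lambda>z. F z + H z) = avg F + avg H"
  by (simp add: avg_def sum.distrib add_divide_distrib)

lemma avg_diff: "avg (\<lambda>z. F z - H z) = avg F - avg H"
  by (simp add: avg_def sum_subtractf diff_divide_distrib)

lemma avg_cmult: "avg (\<lambda>z. a * F z) = a * avg F"
  by (simp add: avg_def sum_distrib_left)

lemma avg_const: "avg (\<lambda>z. a) = a"
  using P_pos by (simp add: avg_def)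

lemma avg_sum: "avg (\<lambda>z. \<Sum>i\<in>I. F i z) = (\<Sum>i\<in>I. avg (F i))"
  unfolding avg_def by (subst sum.swap) (simp add: sum_divide_distrib)

lemma avg_mono: "(\<And>z. norm z = 1 \<Longrightarrow> F z \<le> H z) \<Longrightarrow> avg F \<le> avg H"
  unfolding avg_def by (intro divide_right_mono sum_mono) (simp_all add: norm_Z)

lemma sum_Z_powi:
  assumes "\<bar>t\<bar> \<le> int L"
  shows "(\<Sum>k<P. Z k powi t) = (if t = 0 then of_nat P else 0)"
proof -
  consider "t = 0" | n where "t = int n" "n > 0" | n where "t = - int n" "n > 0"
    by (metis int_cases2 of_nat_0 gr0I minus_zero)
  then show ?thesis
  proof cases
    case 2
    then show ?thesis using sum_Z_power[of n] assms by simp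
  next
    case 3
    have "Z k powi t = cnj (Z k ^ n)" for k
    proof -
      have "Z k powi t = inverse (Z k ^ n)" using 3 by (simp add: power_int_minus)
      also have "\<dots> = cnj (Z k ^ n)"
        by (intro inverse_eq_cnj) (simp add: norm_Z norm_power)
      finally show ?thesis .
    qed
    then show ?thesis using 3 sum_Z_power[of n] assms
      by (simp add: cnj_sum[symmetric] del: cnj_sum complex_cnj_power)
  qed simp
qed

text \<open>Allowing repeated exponents \<open>f i\<close> lets products be averaged without first
  collecting equal exponents.\<close>

lemma complex_avg:
  assumes "\<And>z. norm z = 1 \<Longrightarrow> complex_of_real (F z) = (\<Sum>i\<in>I. c i * z powi f i)"
    and "\<And>i. i \<in> I \<Longrightarrow> \<bar>f i\<bar> \<le> int L" and "finite I"
  shows "complex_of_real (avg F) = (\<Sum>i | i \<in> I \<and> f i = 0. c i)"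
proof -
  have "complex_of_real (avg F) = (\<Sum>k<P. \<Sum>i\<in>I. c i * Z k powi f i) / of_nat P"
    by (simp add: avg_def assms(1) norm_Z)
  also have "\<dots> = (\<Sum>i\<in>I. c i * (\<Sum>k<P. Z k powi f i)) / of_nat P"
    by (subst sum.swap) (simp add: sum_distrib_left)
  also have "\<dots> = (\<Sum>i\<in>I. if f i = 0 then c i else 0)"
    using P_pos assms(2) by (auto simp: sum_Z_powi sum_divide_distrib intro!: sum.cong)
  also have "\<dots> = (\<Sum>i | i \<in> I \<and> f i = 0. c i)"
    using assms(3) by (simp add: sum.inter_filter)
  finally show ?thesis .
qed

text \<open>Parseval's identity. Only differences of frequencies occur in the square, so it is these
  that \<open>L\<close> has to bound.\<close>

lemma avg_norm_square:
  assumes "finite S" "\<And>s t. s \<in> S \<Longrightarrow> t \<in> S \<Longrightarrow> \<bar>s - t\<bar> \<le> int L"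
  shows "avg (\<lambda>z. (norm (\<Sum>t\<in>S. c t * z powi t))\<^sup>2) = (\<Sum>t\<in>S. (norm (c t))\<^sup>2)"
proof -
  have "complex_of_real (avg (\<lambda>z. (norm (\<Sum>t\<in>S. c t * z powi t))\<^sup>2)) =
    (\<Sum>i | i \<in> S \<times> S \<and> fst i - snd i = 0. c (fst i) * cnj (c (snd i)))"
  proof (rule complex_avg)
    fix z :: complex assume z: "norm z = 1"
    then have z0: "z \<noteq> 0" by auto
    have cnj: "cnj (z powi t) = inverse (z powi t)" for t
      by (rule inverse_eq_cnj[symmetric]) (simp add: z norm_power_int)
    show "complex_of_real ((norm (\<Sum>t\<in>S. c t * z powi t))\<^sup>2) =
      (\<Sum>i\<in>S \<times> S. c (fst i) * cnj (c (snd i)) * z powi (fst i - snd i))"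
      unfolding complex_norm_square cnj_sum complex_cnj_mult cnj sum_product sum.cartesian_product
      using z0 by (intro sum.cong) (simp_all add: case_prod_unfold power_int_diff divide_inverse)
  qed (use assms in auto)
  also have "\<dots> = (\<Sum>i\<in>(\<lambda>t. (t, t)) ` S. c (fst i) * cnj (c (snd i)))"
    by (intro sum.cong) auto
  also have "\<dots> = (\<Sum>t\<in>S. c t * cnj (c t))"
    by (subst sum.reindex) (auto simp: inj_on_def)
  also have "\<dots> = complex_of_real (\<Sum>t\<in>S. (norm (c t))\<^sup>2)"
    by (simp only: of_real_sum complex_norm_square)
  finally show ?thesis by (simp only: of_real_eq_iff)
qed

lemma avg_eq_constant_coeff:
  assumes "finite S" "S \<subseteq> {- int L..int L}" 
    and "\<And>z. norm z = 1 \<Longrightarrow> complex_of_real (F z) = (\<Sum>t\<in>S. c t * z powi t)"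
  shows "complex_of_real (avg F) = (if 0 \<in> S then c 0 else 0)"
proof -
  have "complex_of_real (avg F) = (\<Sum>i | i \<in> S \<and> i = 0. c i)"
    using assms by (intro complex_avg) (auto simp: abs_le_iff subset_iff)
  moreover have "{i. i \<in> S \<and> i = 0} = (if 0 \<in> S then {0} else {})" by auto
  ultimately show ?thesis by simp
qed

lemma avg_eq_0:
  assumes "trig_poly S F" "S \<subseteq> {- int L..int L}" "0 \<notin> S"
  shows "avg F = 0"
  using assms avg_eq_constant_coeff[OF trig_poly_finite[OF assms(1)] assms(2)]
  by (metis of_real_eq_0_iff trig_polyE)

text \<open>The frequencies of \<open>H (z powi l)\<close> are multiples of \<open>l\<close>, those
  of \<open>F\<close> are smaller than \<open>l\<close> in absolute value, so
  \<open>e * l + t = 0\<close> forces \<open>e = t = 0\<close>. Hence the constant coefficients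
  multiply.\<close>

lemma avg_mult_indep:
  assumes F: "trig_poly {-T..T} F" and H: "trig_poly {-d..d} H"
    and l: "T < l" "d * l + T \<le> int L" and nn: "0 \<le> T" "0 \<le> d"
  shows "avg (\<lambda>z. H (z powi l) * F z) = avg H * avg F"
proof -
  obtain a where a: "\<And>z. norm z = 1 \<Longrightarrow> complex_of_real (F z) = (\<Sum>t\<in>{-T..T}. a t * z powi t)"
    using F by (metis trig_polyE)
  obtain b where b: "\<And>z. norm z = 1 \<Longrightarrow> complex_of_real (H z) = (\<Sum>t\<in>{-d..d}. b t * z powi t)"
    using H by (metis trig_polyE)
  have dl: "d * 1 \<le> d * l" using nn l by (intro mult_left_mono) auto
  have "complex_of_real (avg F) = a 0" "complex_of_real (avg H) = b 0"
    using avg_eq_constant_coeff[OF _ _ a] avg_eq_constant_coeff[OF _ _ b] nn l dl by simp_all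
  moreover have "complex_of_real (avg (\<lambda>z. H (z powi l) * F z)) =
    (\<Sum>i | i \<in> {-d..d} \<times> {-T..T} \<and> fst i * l + snd i = 0. b (fst i) * a (snd i))"
  proof (rule complex_avg)
    fix z :: complex assume z: "norm z = 1"
    then have z0: "z \<noteq> 0" by auto
    have zl: "norm (z powi l) = 1" using z by (simp add: norm_power_int)
    show "complex_of_real (H (z powi l) * F z) =
      (\<Sum>i\<in>{-d..d} \<times> {-T..T}. b (fst i) * a (snd i) * z powi (fst i * l + snd i))"
      unfolding of_real_mult a[OF z] b[OF zl] sum_product sum.cartesian_product
      using z0 by (intro sum.cong)
        (simp_all add: case_prod_unfold power_int_add power_int_mult mult.commute[of _ l])
  next
    fix i assume i: "i \<in> {-d..d} \<times> {-T..T}"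
    then have "\<bar>fst i\<bar> * l \<le> d * l" using l nn by (intro mult_right_mono) auto
    moreover have "\<bar>fst i * l + snd i\<bar> \<le> \<bar>fst i\<bar> * l + \<bar>snd i\<bar>"
      using abs_triangle_ineq[of "fst i * l" "snd i"] l nn by (simp add: abs_mult)
    moreover have "\<bar>snd i\<bar> \<le> T" using i by auto
    ultimately show "\<bar>fst i * l + snd i\<bar> \<le> int L" using l(2) by linarith
  qed simp
  moreover have "{i. i \<in> {-d..d} \<times> {-T..T} \<and> fst i * l + snd i = 0} = {(0, 0)}"
  proof -
    have "e = 0" if "e * l + t = 0" "\<bar>t\<bar> \<le> T" for e t
    proof (rule ccontr)
      assume "e \<noteq> 0"
      then have "1 * l \<le> \<bar>e\<bar> * l" using l nn by (intro mult_right_mono) auto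
      moreover have "\<bar>e\<bar> * l = \<bar>t\<bar>"
        using that(1) l nn by (metis abs_minus_cancel abs_mult abs_of_pos add_eq_0_iff order_le_less_trans)
      ultimately show False using that l by linarith
    qed
    then show ?thesis using nn by fastforce
  qed
  ultimately have "complex_of_real (avg (\<lambda>z. H (z powi l) * F z)) = complex_of_real (avg H * avg F)"
    by simp
  then show ?thesis by (simp only: of_real_eq_iff)
qed

end

section \<open>Polynomial approximation of the sign of the cosine\<close>

text \<open>
  Iterating \<open>y \<mapsto> (3 y - y\<^sup>3) / 2\<close> turns the cosine into an odd trigonometric polynomial that is
  close to its sign in mean square: \<open>s = 1 - y\<^sup>2\<close> is mapped to \<open>s\<^sup>2 (3 + s) / 4 \<le> s\<^sup>2\<close>.
\<close>

primrec sharpen :: "nat \<Rightarrow> real \<Rightarrow> real" where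
  "sharpen 0 x = x"
| "sharpen (Suc j) x = (3 * sharpen j x - sharpen j x ^ 3) / 2"

lemma abs_sharpen_le_1:
  assumes "\<bar>x\<bar> \<le> 1"
  shows "\<bar>sharpen j x\<bar> \<le> 1"
proof (induction j)
  case (Suc j)
  define y where "y = sharpen j x"
  \<comment> \<open>The two products are \<open>2 - 3 * y + y ^ 3\<close> and
    \<open>2 + 3 * y - y ^ 3\<close>.\<close>
  have "0 \<le> (1 - y)\<^sup>2 * (2 + y)" "0 \<le> (1 + y)\<^sup>2 * (2 - y)"
    using Suc by (auto simp: y_def)
  then have "3 * y - y ^ 3 \<le> 2" "- 2 \<le> 3 * y - y ^ 3"
    by (simp_all add: power2_eq_square power3_eq_cube algebra_simps)
  then show ?case by (simp add: y_def abs_le_iff)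
qed (use assms in simp)

lemma one_minus_sharpen_square_le:
  assumes "\<bar>x\<bar> \<le> 1"
  shows "1 - (sharpen j x)\<^sup>2 \<le> (1 - x\<^sup>2) ^ (2 ^ j)"
proof (induction j)
  case (Suc j)
  define s where "s = 1 - (sharpen j x)\<^sup>2"
  have s: "0 \<le> s" "s \<le> 1"
    using abs_sharpen_le_1[OF assms, of j] by (simp_all add: s_def abs_square_le_1)
  have "1 - (sharpen (Suc j) x)\<^sup>2 = s\<^sup>2 * (3 + s) / 4"
    by (simp add: s_def power2_eq_square power3_eq_cube field_simps)
  also have "\<dots> \<le> s\<^sup>2 * 4 / 4"
    using s by (intro divide_right_mono mult_left_mono) auto
  also have "\<dots> \<le> ((1 - x\<^sup>2) ^ (2 ^ j))\<^sup>2"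
    using s Suc by (simp add: s_def power_mono)
  finally show ?case by (simp add: power_mult[symmetric] mult.commute)
qed simp

text \<open>Each iteration applies an odd cubic: the degree bound triples and the frequencies stay
  odd, which keeps \<open>0\<close> out of the spectrum.\<close>

lemma trig_poly_sharpen:
  "trig_poly ({- (3 ^ j)..3 ^ j} \<inter> {t. odd t}) (\<lambda>z. sharpen j (Re z))"
proof (induction j)
  case 0
  have "trig_poly {-1, 1} Re"
  proof (rule trig_polyI[where c = "\<lambda>_. 1 / 2"])
    fix z :: complex assume z: "norm z = 1"
    have "complex_of_real (Re z) = (z + inverse z) / 2"
      by (simp add: inverse_eq_cnj[OF z] complex_add_cnj)
    then show "complex_of_real (Re z) = (\<Sum>t\<in>{-1, 1}. 1 / 2 * z powi t)"
      by (simp add: power_int_minus field_simps)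
  qed simp
  then have "trig_poly ({-1..1} \<inter> {t. odd t}) Re"
    by (rule trig_poly_mono) auto
  then show ?case by simp
next
  case (Suc j)
  let ?S = "{- (3 ^ j)..3 ^ j} \<inter> {t::int. odd t}"
  let ?U = "{- (3 ^ Suc j)..3 ^ Suc j} \<inter> {t::int. odd t}"
  let ?y = "\<lambda>z. sharpen j (Re z)"
  have "trig_poly ({- (2 * 3 ^ j)..2 * 3 ^ j} \<inter> {t. even t}) (\<lambda>z. ?y z * ?y z)"
    by (rule trig_poly_mult[OF Suc Suc]) auto
  from trig_poly_mult[OF this Suc] have "trig_poly ?U (\<lambda>z. ?y z * ?y z * ?y z)" by auto
  moreover have "trig_poly ?U ?y"
    by (rule trig_poly_mono[OF Suc]) auto
  ultimately have "trig_poly ?U (\<lambda>z. (3/2) * ?y z + (-1/2) * (?y z * ?y z * ?y z))"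
    by (intro trig_poly_add trig_poly_cmult)
  then show ?case by (simp add: power3_eq_cube diff_divide_distrib)
qed

text \<open>From \<open>n\<close> to \<open>Suc n\<close> the left side grows by the factor
  \<open>4 * (2 * n + 1) * (2 * n + 3) / (n + 1)^2\<close>, at most 16 because
  \<open>(2 * n + 1) * (2 * n + 3) \<le> (2 * n + 2)^2\<close>.\<close>

lemma central_binomial_square_le:
  "(real ((2 * n) choose n))\<^sup>2 * (2 * real n + 1) \<le> 16 ^ n"
proof (induction n)
  case (Suc n)
  define b where "b k = real ((2 * k) choose k)" for k
  have b: "b k = fact (2 * k) / (fact k)\<^sup>2" for k
    by (simp add: b_def binomial_fact power2_eq_square mult_2)
  have "b (Suc n) = b n * (2 * (2 * real n + 1) / (real n + 1))"
    by (simp add: b power2_eq_square divide_simps) (simp add: algebra_simps)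
  then have "(b (Suc n))\<^sup>2 * (2 * real (Suc n) + 1) =
      ((b n)\<^sup>2 * (2 * real n + 1)) * (4 * (2 * real n + 1) * (2 * real n + 3) / (real n + 1)\<^sup>2)"
    by (simp add: power2_eq_square algebra_simps)
  also have "\<dots> \<le> 16 ^ n * 16"
  proof (rule mult_mono)
    show "4 * (2 * real n + 1) * (2 * real n + 3) / (real n + 1)\<^sup>2 \<le> 16"
      by (simp add: divide_simps) (simp add: power2_eq_square algebra_simps)
  qed (use Suc in \<open>auto simp: b_def\<close>)
  finally show ?case by (simp add: b_def)
qed simp

section \<open>Mean square of the approximate sign\<close>

context unit_sample
begin

text \<open>On the circle \<open>1 - (Re z)^2\<close> is the squared modulus of
  \<open>(1 - z^2) / 2\<close>. Parseval for the binomial expansion of its \<open>K\<close>-th power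
  leaves the sum of the squared binomial coefficients over \<open>4 ^ K\<close>.\<close>

lemma avg_one_minus_Re_square_power:
  assumes "2 * K \<le> L"
  shows "avg (\<lambda>z. (1 - (Re z)\<^sup>2) ^ K) = real ((2 * K) choose K) / 4 ^ K"
proof -
  define S where "S = (\<lambda>i. 2 * int i) ` {..K}"
  define c :: "int \<Rightarrow> complex" where "c t = (-1) ^ nat (t div 2) * of_nat (K choose nat (t div 2)) / 2 ^ K" for t
  have inj: "inj_on (\<lambda>i. 2 * int i) {..K}" by (auto simp: inj_on_def)
  have pow_4: "((2::real) ^ K)\<^sup>2 = 4 ^ K"
    by (simp add: power2_eq_square flip: power_mult_distrib)
  have eq: "(1 - (Re z)\<^sup>2) ^ K = (norm (\<Sum>t\<in>S. c t * z powi t))\<^sup>2" if z: "norm z = 1" for z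
  proof -
    have "(\<Sum>t\<in>S. c t * z powi t) = (\<Sum>i\<le>K. of_nat (K choose i) * (- (z\<^sup>2)) ^ i * 1 ^ (K - i)) / 2 ^ K"
      unfolding S_def sum.reindex[OF inj] sum_divide_distrib
    proof (intro sum.cong, goal_cases)
      case (2 i)
      have "z powi (2 * int i) = (z\<^sup>2) ^ i"
        by (metis of_nat_mult of_nat_numeral power_int_of_nat power_mult)
      then show ?case by (simp add: c_def power_minus[of "z\<^sup>2"])
    qed simp
    also have "\<dots> = ((1 - z\<^sup>2) / 2) ^ K"
      using binomial_ring[of "- (z\<^sup>2)" 1 K] by (simp add: power_divide)
    finally have "(norm (\<Sum>t\<in>S. c t * z powi t))\<^sup>2 = ((norm ((1 - z\<^sup>2) / 2))\<^sup>2) ^ K"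
      by (simp add: norm_power power_mult[symmetric] mult.commute)
    also have "(norm ((1 - z\<^sup>2) / 2))\<^sup>2 = 1 - (Re z)\<^sup>2"
    proof -
      have "1 - z\<^sup>2 = z * (cnj z - z)"
        using z by (simp add: right_diff_distrib power2_eq_square flip: complex_norm_square)
      moreover have "norm (cnj z - z) = 2 * \<bar>Im z\<bar>"
        by (simp add: cmod_def real_sqrt_mult)
      ultimately have "(norm ((1 - z\<^sup>2) / 2))\<^sup>2 = (Im z)\<^sup>2"
        using z by (simp add: norm_mult norm_divide)
      also have "\<dots> = 1 - (Re z)\<^sup>2" using z cmod_power2[of z] by simp
      finally show ?thesis .
    qed
    finally show ?thesis by simp
  qed
  have "avg (\<lambda>z. (1 - (Re z)\<^sup>2) ^ K) = (\<Sum>t\<in>S. (norm (c t))\<^sup>2)"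
  proof (subst avg_norm_square[symmetric])
    show "\<bar>s - t\<bar> \<le> int L" if "s \<in> S" "t \<in> S" for s t
      using that assms by (auto simp: S_def)
  qed (auto simp: S_def eq[unfolded S_def] intro!: avg_cong)
  also have "\<dots> = (\<Sum>i\<le>K. (real (K choose i))\<^sup>2) / 4 ^ K"
    unfolding S_def sum.reindex[OF inj] sum_divide_distrib
    by (intro sum.cong) (auto simp: c_def norm_mult norm_divide norm_power power_divide pow_4)
  also have "(\<Sum>i\<le>K. (real (K choose i))\<^sup>2) = real ((2 * K) choose K)"
    unfolding choose_square_sum[symmetric] by simp
  finally show ?thesis .
qed

text \<open>With \<open>K = 2 ^ j\<close> the defect is at most the mean of
  \<open>(1 - (Re z)^2) ^ K\<close>, a central binomial coefficient over \<open>4 ^ K\<close>, hence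
  at most \<open>1 / sqrt K\<close>.\<close>

lemma avg_sharpen_square_ge:
  assumes "2 * 2 ^ j \<le> L"
  shows "1 - 1 / sqrt (2 ^ j) \<le> avg (\<lambda>z. (sharpen j (Re z))\<^sup>2)"
proof -
  define K :: nat where "K = 2 ^ j"
  define b where "b = real ((2 * K) choose K) / 4 ^ K"
  have "1 - avg (\<lambda>z. (sharpen j (Re z))\<^sup>2) = avg (\<lambda>z. 1 - (sharpen j (Re z))\<^sup>2)"
    by (simp add: avg_diff avg_const)
  also have "\<dots> \<le> avg (\<lambda>z. (1 - (Re z)\<^sup>2) ^ K)"
    unfolding K_def
    by (intro avg_mono one_minus_sharpen_square_le) (metis abs_Re_le_cmod)
  also have "\<dots> = b" using assms by (simp add: b_def avg_one_minus_Re_square_power K_def)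
  also have "b \<le> 1 / sqrt (2 ^ j)"
  proof -
    have pow_16: "((4::real) ^ K)\<^sup>2 = 16 ^ K"
      by (simp add: power2_eq_square flip: power_mult_distrib)
    have "b\<^sup>2 * (2 * real K + 1) \<le> 1"
      using central_binomial_square_le[of K] pow_16 by (simp add: b_def power_divide field_simps)
    moreover have "b\<^sup>2 * real K \<le> b\<^sup>2 * (2 * real K + 1)" by (intro mult_left_mono) auto
    ultimately have "b\<^sup>2 * 2 ^ j \<le> 1" by (simp add: K_def)
    then have "b\<^sup>2 \<le> 1 / 2 ^ j" by (simp add: field_simps)
    then have "b \<le> sqrt (1 / 2 ^ j)" by (rule real_le_rsqrt)
    then show ?thesis by (simp add: real_sqrt_divide)
  qed
  finally show ?thesis by simp
qed

end

section \<open>Riesz products on a binary tree\<close>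

text \<open>\<open>G\<close> is the approximate sign, \<open>D\<close> bounds its degree,
  \<open>m\<close> is the height of the tree. The base \<open>B\<close> exceeds \<open>2 * D\<close>
  and \<open>D * 2 ^ m\<close>, so multiples and positions can be read off as digits.\<close>

locale riesz_tree = unit_sample +
  fixes G :: "complex \<Rightarrow> real" and D B :: int and m :: nat
  assumes G_trig: "trig_poly ({-D..D} - {0}) G"
    and G_le: "\<And>z. norm z = 1 \<Longrightarrow> \<bar>G z\<bar> \<le> 1"
    and D_pos: "D > 0" and B_eq: "B = 4 * D * 2 ^ m" and L_ge: "(B\<^sup>2) ^ m \<le> int L"
begin

text \<open>
  The frequency attached to a node at level \<open>n\<close> and in-order position \<open>x\<close>. The power of \<open>B\<^sup>2\<close> makes
  frequencies along a path lacunary, so that their gates are independent; the digit \<open>x\<close> makes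
  the spectra of different nodes disjoint, at the price of only exponentially large frequencies in \<open>m\<^sup>2\<close>.
\<close>

definition freq :: "nat \<Rightarrow> nat \<Rightarrow> int" where
  "freq n x = (B\<^sup>2) ^ n * (1 + int x * B)"

text \<open>Bounds the sum of \<open>D * freq i x\<close> along a path through the levels
  \<open>i\<close> below \<open>n\<close>, and so the spectrum of a subtree of height
  \<open>n\<close>.\<close>

definition range_bound :: "nat \<Rightarrow> int" where
  "range_bound n = (\<Sum>i<n. D * (2 ^ m * B * (B\<^sup>2) ^ i))"

text \<open>
  Exponents occurring in the block at position \<open>x\<close>: their lowest nonzero digit in base \<open>B\<^sup>2\<close>
  comes from the gate of that node and reveals both its level and its position.
\<close>

definition own :: "nat \<Rightarrow> nat \<Rightarrow> int set" where
  "own n x = {s. \<exists>i<n. \<exists>e. e \<noteq> 0 \<and> \<bar>e\<bar> \<le> D \<and> [s = e * freq i x] (mod (B\<^sup>2) ^ Suc i)}"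

lemma B_pos: "B > 0"
  using D_pos by (simp add: B_eq)

lemma range_bound_nonneg: "range_bound n \<ge> 0"
  using D_pos B_pos by (simp add: range_bound_def sum_nonneg)

lemma range_bound_mono: "n \<le> k \<Longrightarrow> range_bound n \<le> range_bound k"
  unfolding range_bound_def using D_pos B_pos by (intro sum_mono2) auto

text \<open>As \<open>B = 4 * D * 2 ^ m\<close>, the increment at level \<open>n\<close> is a
  quarter of \<open>(B^2) ^ Suc n\<close>. Each frequency thus exceeds twice the range of the levels
  below it.\<close>

lemma range_bound_less: "2 * range_bound n < (B\<^sup>2) ^ n"
proof (induction n)
  case (Suc n)
  have "1 + 2 * D * 2 ^ m * B \<le> B\<^sup>2"
  proof -
    have "1 \<le> B" using B_pos by simp
    then have "1 * 1 \<le> B * B" by (intro mult_mono) auto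
    then have "1 \<le> B\<^sup>2" by (simp only: power2_eq_square)
    moreover have "B\<^sup>2 = 2 * (2 * D * 2 ^ m * B)" by (simp add: B_eq power2_eq_square)
    ultimately show ?thesis by linarith
  qed
  then have "(1 + 2 * D * 2 ^ m * B) * (B\<^sup>2) ^ n \<le> B\<^sup>2 * (B\<^sup>2) ^ n"
    by (intro mult_right_mono) auto
  then show ?case using Suc by (simp add: range_bound_def algebra_simps)
qed (simp add: range_bound_def)

lemma freq_bounds:
  assumes "x < 2 ^ m"
  shows "(B\<^sup>2) ^ n \<le> freq n x" "freq n x \<le> 2 ^ m * B * (B\<^sup>2) ^ n"
proof -
  have "(B\<^sup>2) ^ n * 1 \<le> freq n x"
    unfolding freq_def using B_pos by (intro mult_left_mono) auto
  then show "(B\<^sup>2) ^ n \<le> freq n x" by simp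
  have "int x + 1 \<le> 2 ^ m" using assms by (metis Suc_eq_plus1 Suc_leI of_nat_1 of_nat_add of_nat_le_iff of_nat_numeral of_nat_power)
  then have "(int x + 1) * B \<le> 2 ^ m * B" using B_pos by (intro mult_right_mono) auto
  then have "1 + int x * B \<le> 2 ^ m * B" using B_pos by (simp add: algebra_simps)
  then have "(B\<^sup>2) ^ n * (1 + int x * B) \<le> (B\<^sup>2) ^ n * (2 ^ m * B)" by (intro mult_left_mono) auto
  then show "freq n x \<le> 2 ^ m * B * (B\<^sup>2) ^ n" by (simp add: freq_def mult.commute)
qed

lemma freq_pos: "x < 2 ^ m \<Longrightarrow> freq n x > 0"
  using freq_bounds(1)[of x n] B_pos by (smt (verit) zero_less_power)

lemma D_freq_le:
  assumes "x < 2 ^ m"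
  shows "range_bound n + D * freq n x \<le> range_bound (Suc n)"
  using mult_left_mono[OF freq_bounds(2)[OF assms], of D n] D_pos by (simp add: range_bound_def)

lemma range_bound_le_L: "n \<le> m \<Longrightarrow> 2 * range_bound n \<le> int L"
  using range_bound_mono[of n m] range_bound_less[of m] L_ge by linarith

text \<open>After division by \<open>(B^2) ^ i\<close> there remains \<open>e * (1 + x * B)\<close>,
  nonzero and at most \<open>D * 2 ^ m * B < B^2\<close> in absolute value.\<close>

lemma own_digit:
  assumes "e \<noteq> 0" "\<bar>e\<bar> \<le> D" "x < 2 ^ m"
  shows "\<not> (B\<^sup>2) ^ Suc i dvd e * freq i x"
proof
  assume "(B\<^sup>2) ^ Suc i dvd e * freq i x"
  then have "B\<^sup>2 * (B\<^sup>2) ^ i dvd (e * (1 + int x * B)) * (B\<^sup>2) ^ i"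
    by (simp add: freq_def ac_simps)
  then have "B\<^sup>2 dvd e * (1 + int x * B)" using B_pos by simp
  moreover have f: "0 < freq 0 x" "freq 0 x \<le> 2 ^ m * B"
    using freq_pos[OF assms(3)] freq_bounds(2)[OF assms(3), of 0] by auto
  then have "e * (1 + int x * B) \<noteq> 0" using assms(1) by (simp add: freq_def)
  ultimately have "\<bar>B\<^sup>2\<bar> \<le> \<bar>e * (1 + int x * B)\<bar>" by (rule dvd_imp_le_int[rotated])
  also have "\<dots> = \<bar>e\<bar> * freq 0 x" using f by (simp add: freq_def abs_mult)
  also have "\<dots> \<le> D * (2 ^ m * B)" using f assms(2) D_pos by (intro mult_mono) auto
  also have "\<dots> < B\<^sup>2" using D_pos B_pos by (simp add: B_eq power2_eq_square)
  finally show False by simp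
qed

lemma zero_notin_own: "x < 2 ^ m \<Longrightarrow> 0 \<notin> own n x"
  using own_digit unfolding own_def by (blast dest: cong_sym cong_0_iff[THEN iffD1])

text \<open>The lowest nonzero digits in base \<open>B^2\<close> are compared. The levels agree, as
  a higher frequency vanishes modulo the lower modulus. On one level, reduction modulo
  \<open>B\<close> gives \<open>e = f\<close> because \<open>2 * D < B\<close>; the next base
  \<open>B\<close> digit gives \<open>e * x = e * y\<close> because
  \<open>D * 2 ^ m < B\<close>.\<close>

lemma own_disjoint:
  assumes "s \<in> own n x" "s \<in> own n y" "x < 2 ^ m" "y < 2 ^ m"
  shows "x = y"
proof -
  obtain i e where i: "e \<noteq> 0" "\<bar>e\<bar> \<le> D" "[s = e * freq i x] (mod (B\<^sup>2) ^ Suc i)"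
    using assms(1) by (auto simp: own_def)
  obtain j f where j: "f \<noteq> 0" "\<bar>f\<bar> \<le> D" "[s = f * freq j y] (mod (B\<^sup>2) ^ Suc j)"
    using assms(2) by (auto simp: own_def)
  have *: False if "i < j" "e \<noteq> 0" "\<bar>e\<bar> \<le> D" "x < 2 ^ m"
    "[s = e * freq i x] (mod (B\<^sup>2) ^ Suc i)" "[s = f * freq j y] (mod (B\<^sup>2) ^ Suc j)" for i j e f x y
  proof -
    have dvd: "(B\<^sup>2) ^ Suc i dvd (B\<^sup>2) ^ j" using that(1) by (intro le_imp_power_dvd) simp
    then have "(B\<^sup>2) ^ Suc i dvd f * freq j y" by (simp add: freq_def)
    moreover have "[s = f * freq j y] (mod (B\<^sup>2) ^ Suc i)"
      using that(6) by (rule cong_dvd_modulus) (use that(1) in \<open>auto intro: le_imp_power_dvd simp del: power_Suc\<close>)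
    ultimately have "(B\<^sup>2) ^ Suc i dvd e * freq i x"
      using cong_dvd_iff[of _ _ "(B\<^sup>2) ^ Suc i"] that(5) cong_sym cong_trans by blast
    then show False using own_digit that by blast
  qed
  have ij: "i = j"
  proof (rule ccontr)
    assume "i \<noteq> j"
    then consider "i < j" | "j < i" by linarith
    then show False
    proof cases
      case 1
      then show False using * i j(3) assms(3) by blast
    next
      case 2
      then show False using * j i(3) assms(4) by blast
    qed
  qed
  have "[e * freq i x = f * freq i y] (mod (B\<^sup>2) ^ Suc i)"
    using i(3) j(3) ij cong_sym cong_trans by blast
  then have "B\<^sup>2 * (B\<^sup>2) ^ i dvd (e * (1 + int x * B) - f * (1 + int y * B)) * (B\<^sup>2) ^ i"
    by (simp add: cong_iff_dvd_diff freq_def algebra_simps)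
  then have d: "B * B dvd e * (1 + int x * B) - f * (1 + int y * B)"
    using B_pos by (simp add: power2_eq_square)
  have small: "D < B" "2 * D < B" "D * 2 ^ m < B"
  proof -
    have "(1::int) \<le> 2 ^ m" by simp
    then have "D * 1 \<le> D * 2 ^ m" using D_pos by (intro mult_left_mono) auto
    moreover have "B = 4 * (D * 2 ^ m)" by (simp add: B_eq)
    ultimately show "D < B" "2 * D < B" "D * 2 ^ m < B" using D_pos by linarith+
  qed
  have "B dvd (e - f) + (e * int x - f * int y) * B"
    using dvd_mult_left[OF d] by (simp only: algebra_simps mult_1_left mult_1_right)
  then have dv: "B dvd e - f" by (subst (asm) dvd_add_left_iff) simp_all
  have ef: "e = f"
  proof (rule ccontr)
    assume "e \<noteq> f"
    then have "\<bar>B\<bar> \<le> \<bar>e - f\<bar>" by (intro dvd_imp_le_int dv) simp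
    then show False using i(2) j(2) small(2) by linarith
  qed
  have "B * B dvd (e * (int x - int y)) * B" using d ef by (simp add: algebra_simps)
  then have dv: "B dvd e * (int x - int y)" using B_pos by simp
  have "int x < 2 ^ m" "int y < 2 ^ m"
    using assms(3,4) by (metis of_nat_less_iff of_nat_numeral of_nat_power)+
  then have "\<bar>int x - int y\<bar> \<le> 2 ^ m" by linarith
  then have "\<bar>e * (int x - int y)\<bar> \<le> D * 2 ^ m"
    unfolding abs_mult using i(2) D_pos by (intro mult_mono) auto
  then have "e * (int x - int y) = 0"
    using dvd_imp_le_int[OF _ dv] small(3) by linarith
  then show "x = y" using i(1) by simp
qed

text \<open>A frequency of level \<open>n\<close> is divisible by \<open>(B^2) ^ n\<close>, so its
  multiples leave the digits of lower levels unchanged.\<close>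

lemma own_shift:
  assumes "s \<in> own n x"
  shows "e * freq n y + s \<in> own (Suc n) x"
proof -
  obtain i f where i: "i < n" "f \<noteq> 0" "\<bar>f\<bar> \<le> D" "[s = f * freq i x] (mod (B\<^sup>2) ^ Suc i)"
    using assms by (auto simp: own_def)
  have "(B\<^sup>2) ^ Suc i dvd (B\<^sup>2) ^ n" using i(1) by (intro le_imp_power_dvd) simp
  then have "(B\<^sup>2) ^ Suc i dvd e * freq n y" by (simp add: freq_def)
  then have "[e * freq n y + s = 0 + f * freq i x] (mod (B\<^sup>2) ^ Suc i)"
    using i(4) by (intro cong_add) (simp_all add: cong_0_iff)
  then show ?thesis using i(1,2,3) unfolding own_def by (auto simp: less_Suc_eq)
qed

lemma own_root: "e \<noteq> 0 \<Longrightarrow> \<bar>e\<bar> \<le> D \<Longrightarrow> e * freq n x \<in> own (Suc n) x"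
  unfolding own_def by (auto intro!: exI[of _ n] exI[of _ e])

text \<open>
  A subtree of height \<open>n\<close> with offset \<open>r\<close> has its nodes at the positions strictly between \<open>r\<close> and
  \<open>r + 2 ^ n\<close>, its root at \<open>r + 2 ^ (n - 1)\<close>; the leaf \<open>x\<close> lies between the nodes \<open>x\<close> and \<open>x + 1\<close>.
  Were the gates exactly \<open>\<plusminus>1\<close>-valued, \<open>weight\<close> would be the indicator of the leaf selected by
  the gates (going left at \<open>+1\<close>), and \<open>block\<close> a Haar function.
\<close>

abbreviation gate :: "nat \<Rightarrow> nat \<Rightarrow> complex \<Rightarrow> real" where
  "gate n x z \<equiv> G (z powi freq n x)"

primrec block :: "nat \<Rightarrow> nat \<Rightarrow> nat \<Rightarrow> complex \<Rightarrow> real" where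
  "block 0 r x z = 0"
| "block (Suc n) r x z =
    (if x < r + 2 ^ n then (1 + gate n (r + 2 ^ n) z) / 2 * block n r x z
     else if x = r + 2 ^ n then gate n (r + 2 ^ n) z
     else (1 - gate n (r + 2 ^ n) z) / 2 * block n (r + 2 ^ n) x z)"

primrec weight :: "nat \<Rightarrow> nat \<Rightarrow> nat \<Rightarrow> complex \<Rightarrow> real" where
  "weight 0 r x z = 1"
| "weight (Suc n) r x z =
    (if x < r + 2 ^ n then (1 + gate n (r + 2 ^ n) z) / 2 * weight n r x z
     else (1 - gate n (r + 2 ^ n) z) / 2 * weight n (r + 2 ^ n) x z)"

definition total :: "nat \<Rightarrow> nat \<Rightarrow> complex \<Rightarrow> real" where
  "total n r z = (\<Sum>y\<in>{r<..<r + 2 ^ n}. block n r y z)"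

text \<open>The partial sum of the blocks up to a leaf, averaged over the leaves with
  \<open>weight\<close> as probability; on the circle this is a convex combination of partial
  sums.\<close>

definition stopped :: "nat \<Rightarrow> nat \<Rightarrow> complex \<Rightarrow> real" where
  "stopped n r z = (\<Sum>x\<in>{r..<r + 2 ^ n}. weight n r x z * (\<Sum>y\<in>{r<..x}. block n r y z))"

definition energy :: "nat \<Rightarrow> nat \<Rightarrow> real" where
  "energy n r = (\<Sum>y\<in>{r<..<r + 2 ^ n}. avg (\<lambda>z. (block n r y z)\<^sup>2))"

lemma norm_gate_le: "norm z = 1 \<Longrightarrow> \<bar>gate n x z\<bar> \<le> 1"
  by (rule G_le) (simp add: norm_power_int)

lemma weight_nonneg: "norm z = 1 \<Longrightarrow> weight n r x z \<ge> 0"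
proof (induction n arbitrary: r)
  case (Suc n)
  then show ?case using norm_gate_le[OF Suc.prems, of n "r + 2 ^ n"] by (auto simp: abs_le_iff)
qed simp

lemma root_less:
  assumes "r + 2 ^ Suc n \<le> 2 ^ m"
  shows "r + 2 ^ n < (2::nat) ^ m"
proof -
  have "r + 2 ^ n < r + 2 ^ Suc n" by simp
  then show ?thesis using assms by (rule less_le_trans)
qed

lemma split_leaves:
  fixes r n :: nat and f :: "nat \<Rightarrow> real"
  shows "(\<Sum>x\<in>{r..<r + 2 ^ Suc n}. f x) =
    (\<Sum>x\<in>{r..<r + 2 ^ n}. f x) + (\<Sum>x\<in>{r + 2 ^ n..<r + 2 ^ n + 2 ^ n}. f x)"
  by (simp add: sum.atLeastLessThan_concat mult_2 add.assoc)

lemma split_nodes: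
  fixes r n :: nat and f :: "nat \<Rightarrow> real"
  shows "(\<Sum>x\<in>{r<..<r + 2 ^ Suc n}. f x) =
    (\<Sum>x\<in>{r<..<r + 2 ^ n}. f x) + f (r + 2 ^ n) + (\<Sum>x\<in>{r + 2 ^ n<..<r + 2 ^ n + 2 ^ n}. f x)"
proof -
  have "{r<..<r + 2 ^ Suc n} =
      insert (r + 2 ^ n) ({r<..<r + 2 ^ n} \<union> {r + 2 ^ n<..<r + 2 ^ n + 2 ^ n})" by auto
  then show ?thesis by (simp add: sum.union_disjoint)
qed

lemma sum_weight: "(\<Sum>x\<in>{r..<r + 2 ^ n}. weight n r x z) = 1"
proof (induction n arbitrary: r)
  case (Suc n)
  let ?g = "gate n (r + 2 ^ n) z"
  have "(\<Sum>x\<in>{r..<r + 2 ^ n}. weight (Suc n) r x z) =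
      (1 + ?g) / 2 * (\<Sum>x\<in>{r..<r + 2 ^ n}. weight n r x z)"
    unfolding sum_distrib_left by (intro sum.cong) auto
  moreover have "(\<Sum>x\<in>{r + 2 ^ n..<r + 2 ^ n + 2 ^ n}. weight (Suc n) r x z) =
      (1 - ?g) / 2 * (\<Sum>x\<in>{r + 2 ^ n..<r + 2 ^ n + 2 ^ n}. weight n (r + 2 ^ n) x z)"
    unfolding sum_distrib_left by (intro sum.cong) auto
  ultimately show ?case unfolding split_leaves Suc by (simp add: field_simps)
qed simp

text \<open>A leaf in the left half sees only blocks of the left subtree; its weight and these
  blocks both carry \<open>(1 + g) / 2\<close>. A leaf in the right half has passed the whole left
  subtree and the root, which yields the middle term.\<close>

lemma stopped_Suc:
  fixes n r z
  defines "g \<equiv> gate n (r + 2 ^ n) z"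
  shows "stopped (Suc n) r z = ((1 + g) / 2)\<^sup>2 * stopped n r z
    + (1 - g) / 2 * ((1 + g) / 2 * total n r z + g)
    + ((1 - g) / 2)\<^sup>2 * stopped n (r + 2 ^ n) z"
proof -
  let ?r = "r + 2 ^ n"
  have distribute: "h * w * (t + h * s) = h * t * w + h\<^sup>2 * (w * s)" for h w t s :: real
    by (simp add: power2_eq_square algebra_simps)
  have left: "(\<Sum>y\<in>{r<..x}. block (Suc n) r y z) = (1 + g) / 2 * (\<Sum>y\<in>{r<..x}. block n r y z)"
    if "x < ?r" for x
    unfolding sum_distrib_left using that by (intro sum.cong) (auto simp: g_def)
  have right: "(\<Sum>y\<in>{r<..x}. block (Suc n) r y z) =
    ((1 + g) / 2 * total n r z + g) + (1 - g) / 2 * (\<Sum>y\<in>{?r<..x}. block n ?r y z)"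
    if "?r \<le> x" for x
  proof -
    have dj: "{r<..<?r} \<inter> {?r<..x} = {}" by auto
    have "r < ?r" by simp
    then have "{r<..x} = insert ?r ({r<..<?r} \<union> {?r<..x})" using that by auto
    then have "(\<Sum>y\<in>{r<..x}. block (Suc n) r y z) = (\<Sum>y\<in>{r<..<?r}. block (Suc n) r y z)
        + block (Suc n) r ?r z + (\<Sum>y\<in>{?r<..x}. block (Suc n) r y z)"
      by (simp add: sum.union_disjoint[OF _ _ dj] del: block.simps)
    also have "(\<Sum>y\<in>{r<..<?r}. block (Suc n) r y z) = (1 + g) / 2 * total n r z"
      unfolding total_def sum_distrib_left by (intro sum.cong) (auto simp: g_def)
    also have "(\<Sum>y\<in>{?r<..x}. block (Suc n) r y z) = (1 - g) / 2 * (\<Sum>y\<in>{?r<..x}. block n ?r y z)"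
      unfolding sum_distrib_left by (intro sum.cong) (auto simp: g_def)
    finally show ?thesis by (simp add: g_def)
  qed
  have "(\<Sum>x\<in>{r..<?r}. weight (Suc n) r x z * (\<Sum>y\<in>{r<..x}. block (Suc n) r y z)) =
      ((1 + g) / 2)\<^sup>2 * stopped n r z"
    unfolding stopped_def sum_distrib_left[of "((1 + g) / 2)\<^sup>2"]
  proof (intro sum.cong refl)
    fix x assume "x \<in> {r..<?r}"
    then have x: "x < ?r" and "weight (Suc n) r x z = (1 + g) / 2 * weight n r x z"
      by (auto simp: g_def)
    then show "weight (Suc n) r x z * (\<Sum>y\<in>{r<..x}. block (Suc n) r y z) =
        ((1 + g) / 2)\<^sup>2 * (weight n r x z * (\<Sum>y\<in>{r<..x}. block n r y z))"
      using distribute[of "(1 + g) / 2" "weight n r x z" 0] by (simp only: left[OF x]) simp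
  qed
  moreover have "(\<Sum>x\<in>{?r..<?r + 2 ^ n}. weight (Suc n) r x z * (\<Sum>y\<in>{r<..x}. block (Suc n) r y z)) =
      (\<Sum>x\<in>{?r..<?r + 2 ^ n}. (1 - g) / 2 * ((1 + g) / 2 * total n r z + g) * weight n ?r x z
        + ((1 - g) / 2)\<^sup>2 * (weight n ?r x z * (\<Sum>y\<in>{?r<..x}. block n ?r y z)))"
  proof (intro sum.cong refl)
    fix x assume x: "x \<in> {?r..<?r + 2 ^ n}"
    then have "weight (Suc n) r x z = (1 - g) / 2 * weight n ?r x z" by (simp add: g_def)
    then show "weight (Suc n) r x z * (\<Sum>y\<in>{r<..x}. block (Suc n) r y z) =
      (1 - g) / 2 * ((1 + g) / 2 * total n r z + g) * weight n ?r x z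
        + ((1 - g) / 2)\<^sup>2 * (weight n ?r x z * (\<Sum>y\<in>{?r<..x}. block n ?r y z))"
      using x right[of x] by (simp only: atLeastLessThan_iff distribute)
  qed
  moreover have "\<dots> = (1 - g) / 2 * ((1 + g) / 2 * total n r z + g)
      + ((1 - g) / 2)\<^sup>2 * stopped n ?r z"
  proof -
    have "(\<Sum>x\<in>A. c * w x + h * u x) = c * (\<Sum>x\<in>A. w x) + h * (\<Sum>x\<in>A. u x)"
      for A :: "nat set" and c h and w u :: "nat \<Rightarrow> real"
      by (simp add: sum.distrib sum_distrib_left)
    then show ?thesis by (simp only: stopped_def sum_weight mult_1_right)
  qed
  ultimately show ?thesis
    unfolding stopped_def[of "Suc n"] split_leaves by linarith
qed

section \<open>Spectra of blocks, weights and stopped sums\<close>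

lemma gate_half_trig:
  assumes "x < 2 ^ m"
  shows "trig_poly ((\<lambda>e. e * freq n x) ` {-D..D}) (\<lambda>z. (1 + a * gate n x z) / 2)"
proof -
  have "trig_poly {-D..D} (\<lambda>z. 1 / 2 + (a / 2) * G z)"
    using D_pos by (intro trig_poly_add trig_poly_const trig_poly_cmult trig_poly_mono[OF G_trig]) auto
  from trig_poly_power_arg[OF this, of "freq n x"] show ?thesis
    using freq_pos[OF assms, of n] by (simp add: add_divide_distrib)
qed

lemma gate_half_trig':
  assumes "x < 2 ^ m"
  shows "trig_poly ((\<lambda>e. e * freq n x) ` {-D..D}) (\<lambda>z. (1 + gate n x z) / 2)"
    "trig_poly ((\<lambda>e. e * freq n x) ` {-D..D}) (\<lambda>z. (1 - gate n x z) / 2)"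
  using gate_half_trig[OF assms, of n 1] gate_half_trig[OF assms, of n "-1"] by simp_all

lemma freq_multiple_add_in_range:
  assumes "x < 2 ^ m" "\<bar>e\<bar> \<le> D" "t \<in> {- range_bound n..range_bound n}"
  shows "e * freq n x + t \<in> {- range_bound (Suc n)..range_bound (Suc n)}"
proof -
  have "\<bar>e * freq n x\<bar> \<le> D * freq n x"
    using mult_right_mono[OF assms(2), of "freq n x"] freq_pos[OF assms(1), of n] by (simp add: abs_mult)
  moreover have "\<bar>t\<bar> \<le> range_bound n" using assms(3) by auto
  ultimately show ?thesis using D_freq_le[OF assms(1), of n] by auto
qed

text \<open>A block starts with the digit of its own node, by \<open>own_root\<close>. Each level
  above multiplies it by a half gate, which adds multiples of a higher frequency and preserves that
  digit by \<open>own_shift\<close>.\<close>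

lemma block_trig:
  assumes "n \<le> m" "r + 2 ^ n \<le> 2 ^ m" "x \<in> {r<..<r + 2 ^ n}"
  shows "trig_poly ({- range_bound n..range_bound n} \<inter> own n x) (block n r x)"
  using assms
proof (induction n arbitrary: r)
  case (Suc n)
  let ?r = "r + 2 ^ n"
  let ?S = "{- range_bound n..range_bound n} \<inter> own n x"
  have half: "r + 2 ^ Suc n = ?r + 2 ^ n" by simp
  have r: "?r < 2 ^ m" using Suc.prems(2) by (rule root_less)
  note range = freq_multiple_add_in_range[OF r]
  have step: "u + t \<in> {- range_bound (Suc n)..range_bound (Suc n)} \<inter> own (Suc n) x"
    if "u \<in> (\<lambda>e. e * freq n ?r) ` {-D..D}" "t \<in> ?S" for u t
    using that range own_shift by (auto simp: abs_le_iff)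
  consider "x < ?r" | "x = ?r" | "?r < x" by linarith
  then show ?case
  proof cases
    case 1
    have "trig_poly ?S (block n r x)" using Suc 1 r by auto
    from trig_poly_mult[OF gate_half_trig'(1)[OF r, of n] this _ step] 1 show ?thesis by simp
  next
    case 2
    have "trig_poly ((\<lambda>e. e * freq n ?r) ` ({-D..D} - {0})) (gate n ?r)"
      using trig_poly_power_arg[OF G_trig] freq_pos[OF r, of n] by simp
    moreover have "(\<lambda>e. e * freq n ?r) ` ({-D..D} - {0}) \<subseteq>
        {- range_bound (Suc n)..range_bound (Suc n)} \<inter> own (Suc n) x"
    proof (rule image_subsetI)
      fix e assume "e \<in> {-D..D} - {0}"
      then have e: "e \<noteq> 0" "\<bar>e\<bar> \<le> D" by auto
      show "e * freq n ?r \<in> {- range_bound (Suc n)..range_bound (Suc n)} \<inter> own (Suc n) x"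
        using range[OF e(2), of 0 n] own_root[OF e, of n ?r] range_bound_nonneg[of n] 2 by simp
    qed
    ultimately show ?thesis using 2 trig_poly_mono by fastforce
  next
    case 3
    have "trig_poly ?S (block n ?r x)" using Suc.IH[of ?r] Suc.prems 3 unfolding half by auto
    from trig_poly_mult[OF gate_half_trig'(2)[OF r, of n] this _ step] 3 show ?thesis by simp
  qed
qed auto

lemma block_trig':
  assumes "n \<le> m" "r + 2 ^ n \<le> 2 ^ m" "x \<in> {r<..<r + 2 ^ n}"
  shows "trig_poly {- range_bound n..range_bound n} (block n r x)"
  by (rule trig_poly_mono[OF block_trig[OF assms]]) auto

lemma weight_trig:
  assumes "r + 2 ^ n \<le> 2 ^ m"
  shows "trig_poly {- range_bound n..range_bound n} (weight n r x)"
  using assms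
proof (induction n arbitrary: r)
  case 0
  then show ?case by (simp add: range_bound_def trig_poly_const)
next
  case (Suc n)
  let ?r = "r + 2 ^ n"
  have half: "r + 2 ^ Suc n = ?r + 2 ^ n" by simp
  have r: "?r < 2 ^ m" using Suc.prems by (rule root_less)
  have step: "u + t \<in> {- range_bound (Suc n)..range_bound (Suc n)}"
    if "u \<in> (\<lambda>e. e * freq n ?r) ` {-D..D}" "t \<in> {- range_bound n..range_bound n}" for u t
    using that freq_multiple_add_in_range[OF r] by (auto simp: abs_le_iff)
  have "trig_poly {- range_bound n..range_bound n} (weight n r x)"
    "trig_poly {- range_bound n..range_bound n} (weight n ?r x)"
    using Suc.IH[of r] Suc.IH[of ?r] Suc.prems unfolding half by auto
  from trig_poly_mult[OF gate_half_trig'(1)[OF r, of n] this(1) _ step]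
    trig_poly_mult[OF gate_half_trig'(2)[OF r, of n] this(2) _ step]
  show ?case by (cases "x < ?r") simp_all
qed

lemma total_trig:
  assumes "n \<le> m" "r + 2 ^ n \<le> 2 ^ m"
  shows "trig_poly {- range_bound n..range_bound n} (total n r)"
  unfolding total_def[abs_def] using assms by (intro trig_poly_sum block_trig') auto

lemma stopped_trig:
  assumes "n \<le> m" "r + 2 ^ n \<le> 2 ^ m"
  shows "trig_poly {- (2 * range_bound n)..2 * range_bound n} (stopped n r)"
  unfolding stopped_def[abs_def]
proof (intro trig_poly_sum)
  fix x assume x: "x \<in> {r..<r + 2 ^ n}"
  have "trig_poly {- range_bound n..range_bound n} (\<lambda>z. \<Sum>y\<in>{r<..x}. block n r y z)"
    using x assms by (intro trig_poly_sum block_trig') auto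
  from trig_poly_mult[OF weight_trig[OF assms(2)] this]
  show "trig_poly {- (2 * range_bound n)..2 * range_bound n}
    (\<lambda>z. weight n r x z * (\<Sum>y\<in>{r<..x}. block n r y z))" by auto
qed simp

section \<open>Mean values of the tree functions\<close>

lemma avg_block:
  assumes "n \<le> m" "r + 2 ^ n \<le> 2 ^ m" "x \<in> {r<..<r + 2 ^ n}"
  shows "avg (block n r x) = 0"
proof (rule avg_eq_0[OF block_trig[OF assms]])
  show "{- range_bound n..range_bound n} \<inter> own n x \<subseteq> {- int L..int L}"
    using range_bound_le_L[OF assms(1)] range_bound_nonneg[of n] by auto
  show "0 \<notin> {- range_bound n..range_bound n} \<inter> own n x"
    using zero_notin_own[of x n] assms by auto
qed

lemma avg_total:
  assumes "n \<le> m" "r + 2 ^ n \<le> 2 ^ m"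
  shows "avg (total n r) = 0"
  unfolding total_def[abs_def] avg_sum using avg_block[OF assms] by simp

text \<open>The doubled ranges admit squares of gates and products of two tree functions. Since
  \<open>freq n x\<close> still exceeds the range of \<open>F\<close>, \<open>avg_mult_indep\<close>
  applies.\<close>

lemma avg_gate_mult:
  assumes "n < m" "x < 2 ^ m" "trig_poly {- (2 * D)..2 * D} H"
    "trig_poly {- (2 * range_bound n)..2 * range_bound n} F"
  shows "avg (\<lambda>z. H (z powi freq n x) * F z) = avg H * avg F"
proof (rule avg_mult_indep[OF assms(4,3)])
  show "2 * range_bound n < freq n x"
    using range_bound_less[of n] freq_bounds(1)[OF assms(2), of n] by linarith
  show "2 * D * freq n x + 2 * range_bound n \<le> int L"
    using D_freq_le[OF assms(2), of n] range_bound_le_L[of "Suc n"] assms(1) by simp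
qed (use range_bound_nonneg D_pos in auto)

definition q :: real where "q = avg (\<lambda>z. (G z)\<^sup>2)"

lemma G_square_trig: "trig_poly {- (2 * D)..2 * D} (\<lambda>z. (G z)\<^sup>2)"
  using trig_poly_mult[OF G_trig G_trig, of "{- (2 * D)..2 * D}"] by (auto simp: power2_eq_square)

lemma G_trig': "trig_poly {- (2 * D)..2 * D} G"
  by (rule trig_poly_mono[OF G_trig]) auto

lemma quadratic_trig: "trig_poly {- (2 * D)..2 * D} (\<lambda>z. a + b * G z + c * (G z)\<^sup>2)"
  using D_pos by (intro trig_poly_add trig_poly_const trig_poly_cmult G_trig' G_square_trig) auto

lemma D_le_L:
  assumes "m \<ge> 1"
  shows "D \<le> int L"
proof -
  have "D * freq 0 0 \<le> range_bound 1" using D_freq_le[of 0 0] by (simp add: range_bound_def)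
  then show ?thesis
    using range_bound_le_L[OF assms] range_bound_nonneg[of 1] by (simp add: freq_def)
qed

lemma avg_quadratic:
  assumes "m \<ge> 1"
  shows "avg (\<lambda>z. a + b * G z + c * (G z)\<^sup>2) = a + c * q"
proof -
  have "avg G = 0" using D_le_L[OF assms] by (intro avg_eq_0[OF G_trig]) auto
  then show ?thesis by (simp add: avg_add avg_cmult avg_const q_def)
qed

lemma avg_quadratic_gate_mult:
  assumes "n < m" "x < 2 ^ m" "trig_poly {- (2 * range_bound n)..2 * range_bound n} F"
  shows "avg (\<lambda>z. (a + b * gate n x z + c * (gate n x z)\<^sup>2) * F z) = (a + c * q) * avg F"
  using avg_gate_mult[OF assms(1,2) quadratic_trig assms(3)] avg_quadratic assms(1) by simp

text \<open>The common value of the energy and of \<open>-2\<close> times the mean of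
  \<open>stopped\<close> at height \<open>n\<close>; for \<open>q = 1\<close> it is
  \<open>n\<close>.\<close>

definition growth :: "nat \<Rightarrow> real" where
  "growth n = q * (\<Sum>i<n. ((1 + q) / 2) ^ i)"

lemma growth_Suc: "growth (Suc n) = q + (1 + q) / 2 * growth n"
  unfolding growth_def sum.lessThan_Suc_shift by (simp add: sum_distrib_left distrib_left ac_simps)

text \<open>
  Stopping at the leaf selected by the gates discards the positive contributions along the path and keeps
  the negative ones, so half of the energy survives in the mean.
\<close>

lemma avg_stopped:
  assumes "n \<le> m" "r + 2 ^ n \<le> 2 ^ m"
  shows "avg (stopped n r) = - growth n / 2"
  using assms
proof (induction n arbitrary: r)
  case 0
  then show ?case by (simp add: stopped_def[abs_def] avg_const growth_def)
next
  case (Suc n)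
  let ?r = "r + 2 ^ n" and ?g = "gate n (r + 2 ^ n)"
  have half: "r + 2 ^ Suc n = ?r + 2 ^ n" by simp
  have r: "?r < 2 ^ m" using Suc.prems(2) by (rule root_less)
  have n: "n < m" "n \<le> m" and le: "r + 2 ^ n \<le> 2 ^ m" "?r + 2 ^ n \<le> 2 ^ m"
    using Suc.prems unfolding half by auto
  have tot: "trig_poly {- (2 * range_bound n)..2 * range_bound n} (total n r)"
    using range_bound_nonneg[of n] by (intro trig_poly_mono[OF total_trig[OF n(2) le(1)]]) auto
  have one: "trig_poly {- (2 * range_bound n)..2 * range_bound n} (\<lambda>z. 1)"
    using range_bound_nonneg[of n] by (intro trig_poly_const) auto
  \<comment> \<open>The recursion sorted by powers of the root gate. Averaging replaces the gate by
    \<open>0\<close> and its square by \<open>q\<close>: each subtree keeps the factor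
    \<open>(1 + q) / 4\<close>, the root contributes \<open>- q / 2\<close>, and
    \<open>total\<close> has mean \<open>0\<close>.\<close>
  have "stopped (Suc n) r z =
      (1/4 + 1/2 * ?g z + 1/4 * (?g z)\<^sup>2) * stopped n r z
    + (1/4 + 0 * ?g z + (-1/4) * (?g z)\<^sup>2) * total n r z
    + (0 + 1/2 * ?g z + (-1/2) * (?g z)\<^sup>2) * 1
    + (1/4 + (-1/2) * ?g z + 1/4 * (?g z)\<^sup>2) * stopped n ?r z" for z
    unfolding stopped_Suc by (simp add: power2_eq_square field_simps)
  then have "avg (stopped (Suc n) r) =
    (1/4 + 1/4 * q) * avg (stopped n r) + (1/4 + (-1/4) * q) * avg (total n r)
    + (0 + (-1/2) * q) * avg (\<lambda>z. 1) + (1/4 + 1/4 * q) * avg (stopped n ?r)"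
    using avg_quadratic_gate_mult[OF n(1) r stopped_trig[OF n(2) le(1)]]
      avg_quadratic_gate_mult[OF n(1) r stopped_trig[OF n(2) le(2)]]
      avg_quadratic_gate_mult[OF n(1) r tot] avg_quadratic_gate_mult[OF n(1) r one]
    by (simp only: avg_add fun_eq_iff[symmetric] cong: avg_cong)
  then show ?case
    using Suc.IH[OF n(2) le(1)] Suc.IH[OF n(2) le(2)] avg_total[OF n(2) le(1)]
    by (simp add: avg_const growth_Suc field_simps)
qed

text \<open>The squares of both half gates have mean \<open>(1 + q) / 4\<close> and the root adds
  \<open>q\<close>, so the two subtrees reproduce the recursion of \<open>growth\<close>.\<close>

lemma energy_eq:
  assumes "n \<le> m" "r + 2 ^ n \<le> 2 ^ m"
  shows "energy n r = growth n"
  using assms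
proof (induction n arbitrary: r)
  case 0
  then show ?case by (simp add: energy_def growth_def)
next
  case (Suc n)
  let ?r = "r + 2 ^ n" and ?g = "gate n (r + 2 ^ n)"
  have half: "r + 2 ^ Suc n = ?r + 2 ^ n" by simp
  have r: "?r < 2 ^ m" using Suc.prems(2) by (rule root_less)
  have n: "n < m" "n \<le> m" and le: "r + 2 ^ n \<le> 2 ^ m" "?r + 2 ^ n \<le> 2 ^ m"
    using Suc.prems unfolding half by auto
  have sq: "trig_poly {- (2 * range_bound n)..2 * range_bound n} (\<lambda>z. (block n r' y z)\<^sup>2)"
    if "r' + 2 ^ n \<le> 2 ^ m" "y \<in> {r'<..<r' + 2 ^ n}" for r' y
    using block_trig'[OF n(2) that]
      trig_poly_mult[of "{- range_bound n..range_bound n}" _ "{- range_bound n..range_bound n}" _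
        "{- (2 * range_bound n)..2 * range_bound n}"]
    by (auto simp: power2_eq_square)
  have one: "trig_poly {- (2 * range_bound n)..2 * range_bound n} (\<lambda>z. 1)"
    using range_bound_nonneg[of n] by (intro trig_poly_const) auto
  have left: "avg (\<lambda>z. (block (Suc n) r y z)\<^sup>2) = (1 + q) / 4 * avg (\<lambda>z. (block n r y z)\<^sup>2)"
    if y: "y \<in> {r<..<?r}" for y
  proof -
    have "(block (Suc n) r y z)\<^sup>2 = (1/4 + 1/2 * ?g z + 1/4 * (?g z)\<^sup>2) * (block n r y z)\<^sup>2" for z
      using y by (simp add: power2_eq_square field_simps)
    then show ?thesis
      using avg_quadratic_gate_mult[OF n(1) r sq[OF le(1) y], of "1/4" "1/2" "1/4"]
      by (simp del: block.simps add: add_divide_distrib)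
  qed
  have right: "avg (\<lambda>z. (block (Suc n) r y z)\<^sup>2) = (1 + q) / 4 * avg (\<lambda>z. (block n ?r y z)\<^sup>2)"
    if y: "y \<in> {?r<..<?r + 2 ^ n}" for y
  proof -
    have "(block (Suc n) r y z)\<^sup>2 = (1/4 + (-1/2) * ?g z + 1/4 * (?g z)\<^sup>2) * (block n ?r y z)\<^sup>2" for z
      using y by (simp add: power2_eq_square field_simps)
    then show ?thesis
      using avg_quadratic_gate_mult[OF n(1) r sq[OF le(2) y], of "1/4" "-1/2" "1/4"]
      by (simp del: block.simps add: add_divide_distrib)
  qed
  have mid: "avg (\<lambda>z. (block (Suc n) r ?r z)\<^sup>2) = q"
    using avg_quadratic_gate_mult[OF n(1) r one, of 0 0 1] by (simp add: avg_const)
  have "energy (Suc n) r = (1 + q) / 4 * energy n r + q + (1 + q) / 4 * energy n ?r"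
    unfolding energy_def split_nodes sum_distrib_left mid
    by (intro arg_cong2[of _ _ _ _ "(+)"] sum.cong refl left right)
  then show ?case
    using Suc.IH[OF n(2) le(1)] Suc.IH[OF n(2) le(2)] by (simp add: growth_Suc field_simps)
qed

section \<open>Rearranged coefficients and the maximal inequality\<close>

lemma obtain_tree_coefficients:
  assumes "m \<ge> 1"
  obtains d :: "int \<Rightarrow> nat" and c :: "int \<Rightarrow> complex" where
    "\<And>t. 1 \<le> d t \<and> d t < 2 ^ m"
    "\<And>x z. x < 2 ^ m \<Longrightarrow> norm z = 1 \<Longrightarrow> complex_of_real (\<Sum>y\<in>{0<..x}. block m 0 y z) =
      (\<Sum>t | t \<in> {- range_bound m..range_bound m} \<and> d t \<le> x. c t * z powi t)"
    "(\<Sum>t\<in>{- range_bound m..range_bound m}. (norm (c t))\<^sup>2) = energy m 0"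
proof -
  let ?R = "{- range_bound m..range_bound m}" and ?I = "{0<..<2 ^ m} :: nat set"
  have "\<exists>C. \<forall>z. norm z = 1 \<longrightarrow> complex_of_real (block m 0 x z) = (\<Sum>t\<in>?R \<inter> own m x. C t * z powi t)"
    if "x \<in> ?I" for x
    using block_trig[of m 0 x] that by (auto simp: trig_poly_def)
  then obtain C where C: "\<And>x z. x \<in> ?I \<Longrightarrow> norm z = 1 \<Longrightarrow>
      complex_of_real (block m 0 x z) = (\<Sum>t\<in>?R \<inter> own m x. C x t * z powi t)"
    by metis
  define owned where "owned t \<longleftrightarrow> (\<exists>x\<in>?I. t \<in> own m x)" for t
  have "(2::nat) ^ 1 \<le> 2 ^ m" using assms by (intro power_increasing) auto
  then have one: "1 \<in> ?I" by auto
  \<comment> \<open>For an owned frequency \<open>t\<close>, \<open>d t\<close> is the only node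
    owning it, so cutting by \<open>d t\<close> adds whole blocks in order. A frequency of no node
    gets the coefficient \<open>0\<close> and the harmless position \<open>1\<close>.\<close>
  define d where "d t = (if owned t then SOME x. x \<in> ?I \<and> t \<in> own m x else 1)" for t
  define c where "c t = (if owned t then C (d t) t else 0)" for t
  have dI: "d t \<in> ?I" and d_own: "owned t \<Longrightarrow> t \<in> own m (d t)" for t
  proof -
    have "(SOME x. x \<in> ?I \<and> t \<in> own m x) \<in> ?I \<and> t \<in> own m (SOME x. x \<in> ?I \<and> t \<in> own m x)"
      if "owned t"
      using that unfolding owned_def by (intro someI_ex[of "\<lambda>x. x \<in> ?I \<and> t \<in> own m x"]) blast
    then show "d t \<in> ?I" "owned t \<Longrightarrow> t \<in> own m (d t)"
      using one by (simp_all only: d_def if_True split: if_split) blast+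
  qed
  have d_eq: "d t = x" "owned t" if "x \<in> ?I" "t \<in> own m x" for t x
  proof -
    show "owned t" using that by (auto simp: owned_def)
    then show "d t = x" using own_disjoint[of t m "d t" x] d_own dI[of t] that by auto
  qed
  have own_iff: "t \<in> own m y \<longleftrightarrow> owned t \<and> d t = y" if "y \<in> ?I" for t y
    using d_eq[OF that, of t] d_own[of t] by blast
  have slice: "{t \<in> {t \<in> ?R. owned t \<and> d t \<le> x}. d t = y} = ?R \<inter> own m y"
    if "y \<in> {0<..x}" "x < 2 ^ m" for x y
  proof -
    have "y \<in> ?I" using that by auto
    then show ?thesis using that by (auto simp: own_iff)
  qed
  have slice': "{t \<in> {t \<in> ?R. owned t}. d t = y} = ?R \<inter> own m y" if "y \<in> ?I" for y
    using own_iff[OF that] by auto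
  have finR: "finite {t. t \<in> ?R \<and> A t}" for A
    by (rule finite_subset[of _ ?R]) auto
  show thesis
  proof (rule that[of d c])
    show "1 \<le> d t \<and> d t < 2 ^ m" for t using dI[of t] by auto
  next
    fix x :: nat and z :: complex assume x: "x < 2 ^ m" and z: "norm z = 1"
    have "(\<Sum>t | t \<in> ?R \<and> d t \<le> x. c t * z powi t) = (\<Sum>t | t \<in> ?R \<and> owned t \<and> d t \<le> x. c t * z powi t)"
      by (rule sum.mono_neutral_right[OF finR]) (auto simp: c_def)
    also have "\<dots> = (\<Sum>y\<in>{0<..x}. \<Sum>t | t \<in> {t \<in> ?R. owned t \<and> d t \<le> x} \<and> d t = y. c t * z powi t)"
      using dI by (intro sum.group[symmetric, OF finR]) auto
    also have "\<dots> = (\<Sum>y\<in>{0<..x}. \<Sum>t\<in>?R \<inter> own m y. C y t * z powi t)"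
    proof (rule sum.cong)
      fix y assume y: "y \<in> {0<..x}"
      then have "y \<in> ?I" using x by auto
      then show "(\<Sum>t | t \<in> {t \<in> ?R. owned t \<and> d t \<le> x} \<and> d t = y. c t * z powi t) =
          (\<Sum>t\<in>?R \<inter> own m y. C y t * z powi t)"
        unfolding slice[OF y x] using d_eq by (intro sum.cong) (auto simp: c_def)
    qed simp
    also have "\<dots> = (\<Sum>y\<in>{0<..x}. complex_of_real (block m 0 y z))"
      using x by (intro sum.cong) (simp_all add: C[OF _ z])
    finally show "complex_of_real (\<Sum>y\<in>{0<..x}. block m 0 y z) =
      (\<Sum>t | t \<in> ?R \<and> d t \<le> x. c t * z powi t)" by simp
  next
    have "(\<Sum>t\<in>?R. (norm (c t))\<^sup>2) = (\<Sum>t | t \<in> ?R \<and> owned t. (norm (c t))\<^sup>2)"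
      by (rule sum.mono_neutral_right) (auto simp: c_def)
    also have "\<dots> = (\<Sum>y\<in>?I. \<Sum>t | t \<in> {t \<in> ?R. owned t} \<and> d t = y. (norm (c t))\<^sup>2)"
      using dI by (intro sum.group[symmetric, OF finR]) auto
    also have "\<dots> = (\<Sum>y\<in>?I. avg (\<lambda>z. (block m 0 y z)\<^sup>2))"
    proof (rule sum.cong)
      fix y assume y: "y \<in> ?I"
      have "(\<Sum>t | t \<in> {t \<in> ?R. owned t} \<and> d t = y. (norm (c t))\<^sup>2) =
          (\<Sum>t\<in>?R \<inter> own m y. (norm (C y t))\<^sup>2)"
        unfolding slice'[OF y] using d_eq[OF y] by (intro sum.cong) (auto simp: c_def)
      also have "\<dots> = avg (\<lambda>z. (norm (\<Sum>t\<in>?R \<inter> own m y. C y t * z powi t))\<^sup>2)"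
        using range_bound_le_L[of m] by (intro avg_norm_square[symmetric]) auto
      also have "\<dots> = avg (\<lambda>z. (block m 0 y z)\<^sup>2)"
        by (intro avg_cong) (simp flip: C[OF y])
      finally show "(\<Sum>t | t \<in> {t \<in> ?R. owned t} \<and> d t = y. (norm (c t))\<^sup>2) =
          avg (\<lambda>z. (block m 0 y z)\<^sup>2)" .
    qed simp
    finally show "(\<Sum>t\<in>?R. (norm (c t))\<^sup>2) = energy m 0" by (simp add: energy_def)
  qed
qed

lemma avg_square_le: "(avg F)\<^sup>2 \<le> avg (\<lambda>z. (F z)\<^sup>2)"
proof -
  define \<mu> where "\<mu> = avg F"
  have "0 \<le> avg (\<lambda>z. (F z - \<mu>)\<^sup>2)"
    using avg_mono[of "\<lambda>z. 0"] by (simp add: avg_const)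
  also have "\<dots> = avg (\<lambda>z. (F z)\<^sup>2 + (- 2 * \<mu>) * F z + \<mu>\<^sup>2)"
    by (intro avg_cong) (simp add: power2_eq_square algebra_simps)
  also have "\<dots> = avg (\<lambda>z. (F z)\<^sup>2) - \<mu>\<^sup>2"
    by (simp only: avg_add avg_cmult avg_const \<mu>_def[symmetric]) (simp add: power2_eq_square)
  finally show ?thesis by (simp add: \<mu>_def)
qed

text \<open>A convex combination of partial sums is dominated by the largest of them in absolute
  value.\<close>

lemma stopped_le_partial_sum:
  assumes "norm z = 1"
  shows "\<exists>x<2 ^ m. \<bar>stopped m 0 z\<bar> \<le> \<bar>\<Sum>y\<in>{0<..x}. block m 0 y z\<bar>"
proof -
  define S where "S x = (\<Sum>y\<in>{0<..x}. block m 0 y z)" for x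
  obtain x where x: "x \<in> {0..<2 ^ m}" "\<And>y. y \<in> {0..<2 ^ m} \<Longrightarrow> \<bar>S y\<bar> \<le> \<bar>S x\<bar>"
  proof -
    have "\<exists>x\<in>{0..<2 ^ m}. \<bar>S x\<bar> = Max ((\<lambda>x. \<bar>S x\<bar>) ` {0..<2 ^ m})"
      using Max_in[of "(\<lambda>x. \<bar>S x\<bar>) ` {0..<2 ^ m}"] by fastforce
    then show thesis by (metis Max_ge finite_atLeastLessThan finite_imageI imageI that)
  qed
  have "\<bar>stopped m 0 z\<bar> \<le> (\<Sum>y\<in>{0..<2 ^ m}. \<bar>weight m 0 y z * S y\<bar>)"
    unfolding stopped_def S_def by (simp add: sum_abs)
  also have "\<dots> \<le> (\<Sum>y\<in>{0..<2 ^ m}. weight m 0 y z * \<bar>S x\<bar>)"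
    using x(2) weight_nonneg[OF assms] by (intro sum_mono) (simp add: abs_mult mult_left_mono)
  also have "\<dots> = \<bar>S x\<bar>"
    using sum_weight[of m 0 z] by (simp flip: sum_distrib_right)
  finally show ?thesis using x(1) unfolding S_def by auto
qed

text \<open>Cuts \<open>X k\<close> whose partial sums dominate \<open>stopped\<close> bound its
  mean square by \<open>A\<close> times the energy. As the mean of \<open>stopped\<close> is
  \<open>- growth m / 2\<close>, this gives \<open>(growth m / 2)^2 \<le> A * growth m\<close>, and
  one factor cancels.\<close>

lemma growth_le_of_maximal_inequality:
  assumes "m \<ge> 1" "A \<ge> 0"
    and maximal: "\<And>(c :: int \<Rightarrow> complex) (d :: int \<Rightarrow> nat) (X :: nat \<Rightarrow> nat).
      (\<And>t. 1 \<le> d t \<and> d t < 2 ^ m) \<Longrightarrow> (\<And>k. X k < 2 ^ m) \<Longrightarrow>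
      (\<Sum>k<P. (norm (\<Sum>t | t \<in> {- range_bound m..range_bound m} \<and> d t \<le> X k. c t * Z k powi t))\<^sup>2) / real P
      \<le> A * (\<Sum>t\<in>{- range_bound m..range_bound m}. (norm (c t))\<^sup>2)"
  shows "growth m \<le> 4 * A"
proof (rule obtain_tree_coefficients[OF assms(1)])
  fix d :: "int \<Rightarrow> nat" and c :: "int \<Rightarrow> complex" assume c: "\<And>t. 1 \<le> d t \<and> d t < 2 ^ m"
    "\<And>x z. x < 2 ^ m \<Longrightarrow> norm z = 1 \<Longrightarrow> complex_of_real (\<Sum>y\<in>{0<..x}. block m 0 y z) =
      (\<Sum>t | t \<in> {- range_bound m..range_bound m} \<and> d t \<le> x. c t * z powi t)"
    "(\<Sum>t\<in>{- range_bound m..range_bound m}. (norm (c t))\<^sup>2) = energy m 0"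
  obtain X where X: "\<And>k. X k < 2 ^ m"
    "\<And>k. \<bar>stopped m 0 (Z k)\<bar> \<le> \<bar>\<Sum>y\<in>{0<..X k}. block m 0 y (Z k)\<bar>"
  proof -
    have "\<forall>k. \<exists>x. x < 2 ^ m \<and> \<bar>stopped m 0 (Z k)\<bar> \<le> \<bar>\<Sum>y\<in>{0<..x}. block m 0 y (Z k)\<bar>"
      using stopped_le_partial_sum[OF norm_Z] by blast
    then show thesis by (rule exE[OF choice]) (blast intro: that)
  qed
  have e: "energy m 0 = growth m" by (rule energy_eq) auto
  have "(growth m / 2)\<^sup>2 = (avg (stopped m 0))\<^sup>2" by (subst avg_stopped) auto
  also have "\<dots> \<le> avg (\<lambda>z. (stopped m 0 z)\<^sup>2)" by (rule avg_square_le)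
  also have "\<dots> \<le> (\<Sum>k<P. (norm (complex_of_real (\<Sum>y\<in>{0<..X k}. block m 0 y (Z k))))\<^sup>2) / real P"
    unfolding avg_def norm_of_real using X(2)
    by (intro divide_right_mono sum_mono) (simp_all add: abs_le_square_iff)
  also have "\<dots> \<le> A * growth m"
    unfolding c(2)[OF X(1) norm_Z] using maximal[OF c(1) X(1), of c] by (simp only: c(3) e)
  finally have "growth m * growth m \<le> (4 * A) * growth m" by (simp add: power2_eq_square)
  moreover have "growth m \<ge> 0"
    using e[symmetric] avg_mono[of "\<lambda>_. 0"]
    by (auto simp: energy_def avg_const intro!: sum_nonneg)
  ultimately show ?thesis
    using assms(2) by (cases "growth m = 0") simp_all
qed

text \<open>For \<open>i < m\<close>, Bernoulli's inequality keeps \<open>((1 + q) / 2) ^ i\<close>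
  above \<open>1 / 2\<close>, as \<open>m * (1 - q) / 2\<close> is at most
  \<open>m / 2 ^ m \<le> 1 / 2\<close>. The remaining factor \<open>q\<close> is at least
  \<open>1 / 2\<close>.\<close>

lemma growth_ge:
  assumes "m \<ge> 1" "1 - 1 / 2 ^ m \<le> q"
  shows "real m / 4 \<le> growth m"
proof -
  have "q \<le> avg (\<lambda>z. 1)"
    unfolding q_def using G_le by (intro avg_mono) (simp add: abs_square_le_1)
  then have q1: "q \<le> 1" by (simp add: avg_const)
  have m2: "real m * 2 \<le> 2 ^ m"
  proof -
    have "Suc k * 2 \<le> 2 ^ Suc k" for k by (induction k) auto
    from this[of "m - 1"] have "m * 2 \<le> 2 ^ m" using assms(1) by simp
    then show ?thesis by (metis of_nat_le_iff of_nat_mult of_nat_numeral of_nat_power)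
  qed
  have "(2::real) ^ 1 \<le> 2 ^ m" using assms(1) by (intro power_increasing) auto
  then have "1 / 2 ^ m \<le> (1 / 2 :: real)" by (simp add: field_simps)
  then have q2: "1 / 2 \<le> q" using assms(2) by linarith
  have powers: "1 / 2 \<le> ((1 + q) / 2) ^ i" if "i < m" for i
  proof -
    have "real i * ((1 - q) / 2) \<le> real m * (1 / 2 ^ m)"
      using that assms(2) q1 by (intro mult_mono) auto
    also have "\<dots> \<le> 1 / 2" using m2 by (simp add: field_simps)
    finally have "1 / 2 \<le> 1 + real i * ((q - 1) / 2)" by (simp add: field_simps)
    also have "\<dots> \<le> (1 + (q - 1) / 2) ^ i" using q2 by (intro Bernoulli_inequality) simp
    also have "1 + (q - 1) / 2 = (1 + q) / 2" by (simp add: field_simps)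
    finally show ?thesis .
  qed
  have "real m * (1 / 2) \<le> (\<Sum>i<m. ((1 + q) / 2) ^ i)"
    using sum_bounded_below[of "{..<m}" "1 / 2" "\<lambda>i. ((1 + q) / 2) ^ i"] powers by simp
  then have "1 / 2 * (real m * (1 / 2)) \<le> growth m"
    unfolding growth_def using q2 by (intro mult_mono) auto
  then show ?thesis by simp
qed

end

section \<open>The lower bound\<close>

lemma Delta_ge:
  assumes p: "prime p" and m: "m \<ge> 1" and le: "2 ^ 2 ^ (16 * m\<^sup>2) \<le> p"
  shows "sqrt (real m) / 4 \<le> Delta p"
proof -
  \<comment> \<open>\<open>L\<close> equals \<open>(B^2) ^ m\<close> for the base
    \<open>B = 2 ^ (5 * m + 2)\<close> fixed below. \<open>Q\<close> is large enough for the
    positions \<open>1, ..., 2 ^ m - 1\<close> to be digits of size at most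
    \<open>Q - 2\<close>.\<close>
  define L :: nat where "L = (2 ^ (10 * m + 4)) ^ m"
  define Q :: nat where "Q = 2 ^ m + 1"
  have L: "L = 2 ^ (10 * m\<^sup>2 + 4 * m)"
    by (simp add: L_def power2_eq_square algebra_simps flip: power_mult)
  have "Q ^ Suc L \<le> 2 ^ 2 ^ (16 * m\<^sup>2)"
  proof -
    have "Q \<le> 2 ^ Suc m" by (simp add: Q_def)
    then have "Q ^ Suc L \<le> (2 ^ Suc m) ^ Suc L" by (rule power_mono) simp
    also have "\<dots> = 2 ^ (Suc m * Suc L)" by (simp only: power_mult)
    also have "\<dots> \<le> 2 ^ 2 ^ (16 * m\<^sup>2)"
    proof (rule power_increasing)
      have "Suc m \<le> 2 ^ m" by (simp add: Suc_le_eq)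
      moreover have "Suc L \<le> 2 ^ Suc (10 * m\<^sup>2 + 4 * m)" by (simp add: L)
      ultimately have "Suc m * Suc L \<le> 2 ^ m * 2 ^ Suc (10 * m\<^sup>2 + 4 * m)" by (rule mult_le_mono)
      also have "\<dots> = 2 ^ (m + Suc (10 * m\<^sup>2 + 4 * m))" by (simp only: power_add)
      also have "\<dots> \<le> 2 ^ (16 * m\<^sup>2)"
      proof (rule power_increasing)
        have "m * 1 \<le> m\<^sup>2" "1 * 1 \<le> m\<^sup>2" unfolding power2_eq_square using m by (intro mult_le_mono; simp)+
        then show "m + Suc (10 * m\<^sup>2 + 4 * m) \<le> 16 * m\<^sup>2" by linarith
      qed simp
      finally show "Suc m * Suc L \<le> 2 ^ (16 * m\<^sup>2)" .
    qed simp
    finally show ?thesis .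
  qed
  then have pQ: "Q ^ Suc L \<le> p" using le by linarith
  have Q2: "Q \<ge> 2" by (simp add: Q_def)
  have L1: "L \<ge> 1" by (simp add: L)
  show ?thesis
  proof (rule obtain_rearranged_exponentials[OF p Q2 pQ L1])
    fix Z :: "nat \<Rightarrow> complex" assume Z: "\<And>k. norm (Z k) = 1"
      "\<And>t. 0 < t \<Longrightarrow> t \<le> L \<Longrightarrow> (\<Sum>k<p - 1. Z k ^ t) = 0"
      "\<And>c d x. (\<And>t. t < L \<Longrightarrow> 1 \<le> d t \<and> d t + 2 \<le> Q) \<Longrightarrow> (\<And>k. k < p - 1 \<Longrightarrow> x k < Q - 1) \<Longrightarrow>
        (\<Sum>k<p - 1. (norm (\<Sum>t | t < L \<and> d t \<le> x k. c t * Z k ^ t))\<^sup>2) / real (p - 1)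
        \<le> (Delta p)\<^sup>2 * (\<Sum>t<L. (norm (c t))\<^sup>2)"
    \<comment> \<open>\<open>2 * m\<close> iterations give \<open>1 - q \<le> 1 / 2 ^ m\<close> at
      degree \<open>9 ^ m\<close>, which \<open>16 ^ m\<close> dominates; a power of two makes
      \<open>B\<close> a power of two as well.\<close>
    define D :: int where "D = 16 ^ m"
    define B :: int where "B = 4 * D * 2 ^ m"
    define G where "G z = sharpen (2 * m) (Re z)" for z
    have p2: "p \<ge> 2" using p by (rule prime_ge_2_nat)
    have BL: "(B\<^sup>2) ^ m = int L"
    proof -
      have "B = 2 ^ (5 * m + 2)" by (simp add: B_def D_def power_add power_mult flip: power_mult_distrib)
      then have "B\<^sup>2 = 2 ^ ((5 * m + 2) * 2)" by (simp only: power_mult)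
      also have "(5 * m + 2) * 2 = 10 * m + 4" by simp
      finally have "B\<^sup>2 = 2 ^ (10 * m + 4)" .
      then show ?thesis by (simp add: L_def)
    qed
    interpret riesz_tree "p - 1" Z L G D B m
    proof unfold_locales
      show "trig_poly ({- D..D} - {0}) G"
      proof (rule trig_poly_mono[OF trig_poly_sharpen[of "2 * m", folded G_def]])
        have "(3::int) ^ (2 * m) \<le> D" by (simp add: D_def power_mult power_mono)
        then show "{- (3 ^ (2 * m))..3 ^ (2 * m)} \<inter> {t. odd t} \<subseteq> {- D..D} - {0}" by auto
      qed simp
      show "\<bar>G z\<bar> \<le> 1" if "norm z = 1" for z
        unfolding G_def using that by (intro abs_sharpen_le_1) (metis abs_Re_le_cmod)
    qed (use p2 Z(1,2) BL in \<open>auto simp: D_def B_def\<close>)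
    have "growth m \<le> 4 * (Delta p)\<^sup>2"
    proof (rule growth_le_of_maximal_inequality[OF m])
      fix c :: "int \<Rightarrow> complex" and d :: "int \<Rightarrow> nat" and X :: "nat \<Rightarrow> nat"
      assume d: "\<And>t. 1 \<le> d t \<and> d t < 2 ^ m" and X: "\<And>k. X k < 2 ^ m"
      let ?R = "range_bound m"
      \<comment> \<open>Frequencies symmetric about \<open>0\<close> are moved to
        \<open>0, ..., 2 * ?R\<close> to become natural exponents, at the cost of a factor
        \<open>Z k powi ?R\<close> of modulus 1. Zero coefficients fill up the range to
        \<open>L\<close>.\<close>
      define sh where "sh t = int t - ?R" for t
      define T where "T = nat (2 * ?R + 1)"
      have R: "2 * ?R < int L" using range_bound_less[of m] BL by simp
      then have TL: "T \<le> L" using range_bound_nonneg[of m] by (simp add: T_def)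
      have bij: "bij_betw sh {t. t < T \<and> d (sh t) \<le> x} {t \<in> {- ?R..?R}. d t \<le> x}" for x
        using range_bound_nonneg[of m]
        by (intro bij_betwI[where g = "\<lambda>t. nat (t + ?R)"]) (auto simp: sh_def T_def)
      have bij': "bij_betw sh {..<T} {- ?R..?R}"
        using range_bound_nonneg[of m]
        by (intro bij_betwI[where g = "\<lambda>t. nat (t + ?R)"]) (auto simp: sh_def T_def)
      define c' where "c' t = (if t < T then c (sh t) else 0)" for t
      have "(\<Sum>k<p - 1. (norm (\<Sum>t | t < L \<and> d (sh t) \<le> X k. c' t * Z k ^ t))\<^sup>2) / real (p - 1)
          \<le> (Delta p)\<^sup>2 * (\<Sum>t<L. (norm (c' t))\<^sup>2)"
        using d X by (intro Z(3)) (auto simp: Q_def Suc_le_eq)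
      moreover have "(\<Sum>t<L. (norm (c' t))\<^sup>2) = (\<Sum>t\<in>{- ?R..?R}. (norm (c t))\<^sup>2)"
      proof -
        have "(\<Sum>t<L. (norm (c' t))\<^sup>2) = (\<Sum>t<T. (norm (c' t))\<^sup>2)"
          using TL by (intro sum.mono_neutral_right) (auto simp: c'_def)
        also have "\<dots> = (\<Sum>t<T. (norm (c (sh t)))\<^sup>2)" by (simp add: c'_def)
        also have "\<dots> = (\<Sum>t\<in>{- ?R..?R}. (norm (c t))\<^sup>2)" by (rule sum.reindex_bij_betw[OF bij'])
        finally show ?thesis .
      qed
      moreover have "norm (\<Sum>t | t < L \<and> d (sh t) \<le> X k. c' t * Z k ^ t) =
          norm (\<Sum>t | t \<in> {- ?R..?R} \<and> d t \<le> X k. c t * Z k powi t)" for k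
      proof -
        have Zk: "Z k ^ t = Z k powi ?R * Z k powi sh t" for t
        proof -
          have "Z k powi (?R + sh t) = Z k powi ?R * Z k powi sh t" by (rule power_int_add) simp
          then show ?thesis by (simp add: sh_def)
        qed
        have "(\<Sum>t | t < L \<and> d (sh t) \<le> X k. c' t * Z k ^ t) = (\<Sum>t | t < T \<and> d (sh t) \<le> X k. c' t * Z k ^ t)"
          using TL by (intro sum.mono_neutral_right) (auto simp: c'_def)
        also have "\<dots> = (\<Sum>t | t < T \<and> d (sh t) \<le> X k. Z k powi ?R * (c (sh t) * Z k powi sh t))"
          by (intro sum.cong) (auto simp: c'_def Zk)
        also have "\<dots> = Z k powi ?R * (\<Sum>t | t \<in> {- ?R..?R} \<and> d t \<le> X k. c t * Z k powi t)"
          by (simp only: sum.reindex_bij_betw[OF bij, of "\<lambda>t. c t * Z k powi t"] sum_distrib_left[symmetric])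
        finally show ?thesis by (simp add: norm_mult norm_power_int norm_Z)
      qed
      ultimately show "(\<Sum>k<p - 1. (norm (\<Sum>t | t \<in> {- ?R..?R} \<and> d t \<le> X k. c t * Z k powi t))\<^sup>2) / real (p - 1)
          \<le> (Delta p)\<^sup>2 * (\<Sum>t\<in>{- ?R..?R}. (norm (c t))\<^sup>2)" by simp
    qed simp
    moreover have "real m / 4 \<le> growth m"
    proof (rule growth_ge[OF m])
      have "2 * 2 ^ (2 * m) \<le> L"
      proof -
        have "2 * 2 ^ (2 * m) = (2::nat) ^ (2 * m + 1)" by simp
        also have "\<dots> \<le> 2 ^ (10 * m\<^sup>2 + 4 * m)" using m by (intro power_increasing) auto
        finally show ?thesis by (simp add: L)
      qed
      then show "1 - 1 / 2 ^ m \<le> q"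
        using avg_sharpen_square_ge[of "2 * m"] unfolding q_def G_def
        by (simp add: mult.commute[of 2 m] power_mult)
    qed
    ultimately have "real m / 16 \<le> (Delta p)\<^sup>2" by simp
    then have "sqrt (real m / 16) \<le> Delta p"
      using maximal_sieve_bound_nonneg[OF p2 maximal_sieve_bound_Delta[OF p2]] by (intro real_le_lsqrt) auto
    then show ?thesis by (simp add: real_sqrt_divide)
  qed
qed

text \<open>At most \<open>N\<close> primes lie below \<open>N\<close>, so once \<open>X\<close>
  admits \<open>2 * N + 1\<close> primes at least half of them remain.\<close>

lemma positive_relative_density_primes_ge:
  "positive_relative_density_in_primes {p. prime p \<and> p \<ge> N}"
proof -
  let ?\<pi> = "\<lambda>X. card {p::nat. prime p \<and> real p \<le> X}"
  let ?\<sigma> = "\<lambda>X. card {p \<in> {p. prime p \<and> p \<ge> N}. real p \<le> X}"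
  have fin: "finite {p::nat. real p \<le> X}" for X
    by (rule finite_subset[of _ "{..nat \<lfloor>X\<rfloor>}"]) (auto simp: le_nat_floor)
  obtain A where A: "A \<subseteq> {p::nat. prime p}" "finite A" "card A = 2 * N + 1"
    using infinite_arbitrarily_large[OF primes_infinite] by metis
  have half: "1 / 2 \<le> real (?\<sigma> X) / real (?\<pi> X)" if X: "real (Max A) \<le> X" for X
  proof -
    have "A \<subseteq> {p. prime p \<and> real p \<le> X}"
      using A X by (auto intro: order_trans[of _ "real (Max A)"])
    then have "2 * N + 1 \<le> ?\<pi> X"
      using card_mono[of "{p. prime p \<and> real p \<le> X}" A] fin[of X] A(3) by (simp add: conj_commute)
    moreover have "?\<pi> X \<le> ?\<sigma> X + N"
    proof -
      have "?\<pi> X \<le> card ({p \<in> {p. prime p \<and> p \<ge> N}. real p \<le> X} \<union> {..<N})"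
        using fin[of X] by (intro card_mono) auto
      also have "\<dots> \<le> ?\<sigma> X + card {..<N}" by (rule card_Un_le)
      finally show ?thesis by simp
    qed
    ultimately show ?thesis by (simp add: field_simps)
  qed
  have "ereal (1 / 2) \<le> Liminf at_top (\<lambda>X. ereal (real (?\<sigma> X) / real (?\<pi> X)))"
  proof (rule Liminf_bounded)
    show "\<forall>\<^sub>F X in at_top. ereal (1 / 2) \<le> ereal (real (?\<sigma> X) / real (?\<pi> X))"
      using eventually_ge_at_top[of "real (Max A)"]
      by (rule eventually_mono) (simp only: ereal_less_eq half)
  qed
  moreover have "(0::ereal) < ereal (1 / 2)" by simp
  ultimately show ?thesis
    unfolding positive_relative_density_in_primes_def by (rule less_le_trans[rotated])
qed

theorem theorem1:
  shows "\<exists>(c::real) (S::nat set).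
           c > 0 \<and>
           S \<subseteq> {p. prime p \<and> p \<ge> 3} \<and>
           positive_relative_density_in_primes S \<and>
           (\<forall>p\<in>S. c * (ln (ln (real p))) powr (1/4) \<le> Delta p)"
proof -
  define h :: "nat \<Rightarrow> nat" where "h m = 2 ^ 2 ^ (16 * m\<^sup>2)" for m
  define S where "S = {p::nat. prime p \<and> p \<ge> max 3 (h 1)}"
  have "1 / 12 * ln (ln (real p)) powr (1 / 4) \<le> Delta p" if "p \<in> S" for p
  proof -
    have p: "prime p" "p \<ge> 3" "h 1 \<le> p" using that by (auto simp: S_def)
    have "k < h k" for k
    proof -
      have "k \<le> 16 * k\<^sup>2" by (simp add: power2_eq_square)
      also have "\<dots> < 2 ^ (16 * k\<^sup>2)" by simp
      also have "\<dots> < h k" unfolding h_def by (rule less_exp)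
      finally show ?thesis .
    qed
    then have bound: "k \<le> p" if "h k \<le> p" for k using that by (meson less_le_trans less_imp_le)
    \<comment> \<open>By maximality \<open>p < h (Suc m)\<close>, so
      \<open>ln (ln p) \<le> 16 * (m + 1)^2 \<le> (8 * m)^2\<close>, whose fourth root is
      \<open>sqrt (8 * m) \<le> 3 * sqrt m\<close>. Together with the factor \<open>1 / 4\<close> in
      \<open>Delta_ge\<close> this explains \<open>1 / 12\<close>.\<close>
    define m where "m = (GREATEST k. h k \<le> p)"
    have m: "h m \<le> p" "1 \<le> m"
      unfolding m_def using GreatestI_nat[of "\<lambda>k. h k \<le> p", OF p(3) bound]
        Greatest_le_nat[of "\<lambda>k. h k \<le> p", OF p(3) bound] by blast+
    have "\<not> h (Suc m) \<le> p"
    proof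
      assume "h (Suc m) \<le> p"
      then have "Suc m \<le> m"
        using Greatest_le_nat[of "\<lambda>k. h k \<le> p", OF _ bound] by (simp only: m_def[symmetric])
      then show False by simp
    qed
    then have "real p \<le> real (h (Suc m))" by simp
    also have "\<dots> = 2 ^ 2 ^ (16 * (Suc m)\<^sup>2)" by (simp only: h_def of_nat_power of_nat_numeral)
    finally have "ln (real p) \<le> ln (2 ^ 2 ^ (16 * (Suc m)\<^sup>2))" using p by (intro ln_mono) auto
    also have "\<dots> = 2 ^ (16 * (Suc m)\<^sup>2) * ln 2" by (subst ln_realpow) simp_all
    also have "\<dots> \<le> 2 ^ (16 * (Suc m)\<^sup>2) * 1" using ln_2_less_1 by (intro mult_left_mono) auto
    finally have lnp: "ln (real p) \<le> 2 ^ (16 * (Suc m)\<^sup>2)" by simp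
    have "1 = ln (exp 1 :: real)" by simp
    also have "\<dots> \<le> ln (real p)" using exp_le p(2) by (intro ln_mono) auto
    finally have lnp1: "1 \<le> ln (real p)" .
    have "ln (ln (real p)) \<le> ln (2 ^ (16 * (Suc m)\<^sup>2))" using lnp lnp1 by (intro ln_mono) auto
    also have "\<dots> = real (16 * (Suc m)\<^sup>2) * ln 2" by (rule ln_realpow)
    also have "\<dots> \<le> real (16 * (Suc m)\<^sup>2) * 1" using ln_2_less_1 by (intro mult_left_mono) auto
    also have "\<dots> \<le> real (16 * (2 * m)\<^sup>2)"
      using m(2) by (simp only: mult_1_right of_nat_le_iff) (intro mult_le_mono power_mono; simp)
    also have "\<dots> = (8 * real m) powr 2" using m(2) by (simp add: power2_eq_square)
    finally have "ln (ln (real p)) \<le> (8 * real m) powr 2" .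
    then have "ln (ln (real p)) powr (1 / 4) \<le> ((8 * real m) powr 2) powr (1 / 4)"
      using lnp1 by (intro powr_mono2) auto
    also have "\<dots> = sqrt (8 * real m)" unfolding powr_powr by (simp add: powr_half_sqrt)
    also have "\<dots> \<le> sqrt (9 * real m)" by simp
    also have "\<dots> = 3 * sqrt (real m)" by (simp add: real_sqrt_mult)
    finally have "1 / 12 * ln (ln (real p)) powr (1 / 4) \<le> sqrt (real m) / 4" by simp
    also have "\<dots> \<le> Delta p" using Delta_ge[OF p(1) m(2)] m(1) by (simp only: h_def)
    finally show ?thesis .
  qed
  moreover have "positive_relative_density_in_primes S"
    unfolding S_def by (rule positive_relative_density_primes_ge)
  ultimately show ?thesis
    by (intro exI[of _ "1 / 12"] exI[of _ S]) (auto simp: S_def)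
qed

end
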